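(* For any Lipschitz bounded domain $\Omega\subset\mathbb{R}^2$ there exist a point $x_0\in\partial\Omega$ and, for small $\varepsilon>0$, a solution $u_\varepsilon$ of $$-\Delta u_\varepsilon=\frac1{\varepsilon^2}u_\varepsilon(1-|u_\varepsilon|^2)\ \text{ in }\Omega,\qquad u_\varepsilon=g_\varepsilon\ \text{ on }\partial\Omega,$$ such that for small $\varepsilon>0$ one has $u_\varepsilon(x_0)=0$, while $$M_\varepsilon\le C\qquad\text{and}\qquad N_\varepsilon\le\frac{C}{\varepsilon},$$ where $C>0$ depends only on the Lipschitz regularity of $\Omega$ (in particular not on $\varepsilon$).
   Context: A Lipschitz bounded domain is a bounded open connected set with Lipschitz boundary. $\tau$ is the unit tangent on $\partial\Omega$. For $u_\varepsilon:\Omega\to\mathbb{R}^2$ with boundary data $g_\varepsilon:\partial\Omega\to\mathbb{R}^2$, set $$N_\varepsilon=\int_{\partial\Omega}\frac12|\partial_\tau g_\varepsilon|^2+\frac1{4\varepsilon^2}(1-|g_\varepsilon|^2)^2\,d\mathcal{H}^1,\qquad M_\varepsilon=\int_\Omega\frac12|\nabla u_\varepsilon|^2+\frac1{4\varepsilon^2}(1-|u_\varepsilon|^2)^2\,dx.$$ Since $x_0\in\partial\Omega$, $u_\varepsilon(x_0)$ means $g_\varepsilon(x_0)$ (with $g_\varepsilon$ continuous). "Depending only on the Lipschitz regularity of $\Omega$" means depending only on a pair $(\rho_0,\theta_0)\in(0,\infty)\times(0,\pi)$ such that for every $x\in\partial\Omega$ there is a cone of vertex $x$, radius $\rho_0$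 and opening angle $\theta_0$ included in $\overline\Omega$, the opposite cone being included in $\mathbb{R}^2\setminus\Omega$. *)

theory Defs
  imports "HOL-Analysis.Analysis"
begin

section \<open>The one-dimensional Hausdorff measure\<close>

text \<open>Covers are by bounded sets because \<^const>\<open>diameter\<close> is unspecified on unbounded ones.\<close>

definition fine_covers :: "real \<Rightarrow> 'a::metric_space set \<Rightarrow> (nat \<Rightarrow> 'a set) set" where
  "fine_covers \<delta> A =
     {B. A \<subseteq> (\<Union>i. B i) \<and> (\<forall>i. bounded (B i) \<and> diameter (B i) \<le> \<delta>)}"

definition hausdorff_content :: "real \<Rightarrow> 'a::metric_space set \<Rightarrow> ennreal" where
  "hausdorff_content \<delta> A = (INF B\<in>fine_covers \<delta> A. \<Sum>i. ennreal (diameter (B i)))"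

definition hausdorff_outer :: "'a::metric_space set \<Rightarrow> ennreal" where
  "hausdorff_outer A = (SUP \<delta>\<in>{0<..}. hausdorff_content \<delta> A)"

definition hausdorff_measure :: "'a::metric_space measure" where
  "hausdorff_measure = measure_of UNIV (sets borel) hausdorff_outer"

text \<open>\<^const>\<open>measure_of\<close> yields the zero measure when its argument is not
  countably additive, so this is verified below (Caratheodory's criterion for metric outer
  measures).\<close>

lemma hausdorff_content_le:
  "B \<in> fine_covers \<delta> A \<Longrightarrow> hausdorff_content \<delta> A \<le> (\<Sum>i. ennreal (diameter (B i)))"
  unfolding hausdorff_content_def by (rule INF_lower)

lemma hausdorff_content_le_outer:
  "0 < \<delta> \<Longrightarrow> hausdorff_content \<delta> A \<le> hausdorff_outer A"
  unfolding hausdorff_outer_def by (rule SUP_upper) simp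

lemma hausdorff_content_antimono:
  "\<delta> \<le> \<delta>' \<Longrightarrow> hausdorff_content \<delta>' A \<le> hausdorff_content \<delta> A"
  unfolding hausdorff_content_def by (rule INF_superset_mono) (auto simp: fine_covers_def intro: order_trans)

lemma hausdorff_content_mono:
  "A \<subseteq> A' \<Longrightarrow> hausdorff_content \<delta> A \<le> hausdorff_content \<delta> A'"
  unfolding hausdorff_content_def by (rule INF_superset_mono) (auto simp: fine_covers_def)

lemma hausdorff_outer_mono: "A \<subseteq> A' \<Longrightarrow> hausdorff_outer A \<le> hausdorff_outer A'"
  unfolding hausdorff_outer_def by (rule SUP_mono) (auto intro: hausdorff_content_mono)

lemma hausdorff_outer_empty [simp]: "hausdorff_outer {} = 0"
proof -
  have "hausdorff_content \<delta> ({}::'a set) \<le> 0" if "0 < \<delta>" for \<delta>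
    using hausdorff_content_le[of "\<lambda>_. {}" \<delta> "{}"] that by (simp add: fine_covers_def)
  then have "hausdorff_outer ({}::'a set) \<le> 0"
    unfolding hausdorff_outer_def by (intro SUP_least) simp
  then show ?thesis by simp
qed

lemma hausdorff_content_UN_le:
  fixes A :: "nat \<Rightarrow> 'a::metric_space set"
  shows "hausdorff_content \<delta> (\<Union>n. A n) \<le> (\<Sum>n. hausdorff_content \<delta> (A n))"
proof (rule ennreal_le_epsilon)
  fix e :: real
  assume e: "0 < e" and fin: "(\<Sum>n. hausdorff_content \<delta> (A n)) < top"
  have "hausdorff_content \<delta> (A n) < hausdorff_content \<delta> (A n) + ennreal (e * (1/2) ^ Suc n)" for n
    using fin e by (auto simp: less_top dest!: ennreal_suminf_lessD)
  then have "\<exists>B\<in>fine_covers \<delta> (A n). (\<Sum>i. ennreal (diameter (B i)))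
      < hausdorff_content \<delta> (A n) + ennreal (e * (1/2) ^ Suc n)" for n
    unfolding hausdorff_content_def by (simp only: INF_less_iff)
  then obtain B where B: "\<And>n. B n \<in> fine_covers \<delta> (A n)"
    and le: "\<And>n. (\<Sum>i. ennreal (diameter (B n i)))
      < hausdorff_content \<delta> (A n) + ennreal (e * (1/2) ^ Suc n)"
    by metis
  define K where "K = (\<lambda>k. case prod_decode k of (n, i) \<Rightarrow> B n i)"
  have "(\<Union>n. A n) \<subseteq> (\<Union>k. K k)"
  proof
    fix x assume "x \<in> (\<Union>n. A n)"
    then obtain n where "x \<in> A n" by blast
    then obtain i where "x \<in> B n i" using B[of n] by (auto simp: fine_covers_def)
    then have "x \<in> K (prod_encode (n, i))" by (simp add: K_def)
    then show "x \<in> (\<Union>k. K k)" by blast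
  qed
  moreover have "bounded (K k) \<and> diameter (K k) \<le> \<delta>" for k
    using B by (auto simp: K_def fine_covers_def split: prod.split)
  ultimately have "K \<in> fine_covers \<delta> (\<Union>n. A n)"
    by (simp add: fine_covers_def)
  then have "hausdorff_content \<delta> (\<Union>n. A n) \<le> (\<Sum>k. ennreal (diameter (K k)))"
    by (rule hausdorff_content_le)
  also have "\<dots> = (\<Sum>k. (\<lambda>(n, i). ennreal (diameter (B n i))) (prod_decode k))"
    by (simp add: K_def case_prod_beta)
  also have "\<dots> = (\<Sum>n. \<Sum>i. ennreal (diameter (B n i)))"
    by (rule suminf_ennreal_2dimen) simp
  also have "\<dots> \<le> (\<Sum>n. hausdorff_content \<delta> (A n) + ennreal (e * (1/2) ^ Suc n))"
    by (intro suminf_le less_imp_le[OF le]) auto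
  also have "\<dots> = (\<Sum>n. hausdorff_content \<delta> (A n)) + (\<Sum>n. ennreal (e * (1/2) ^ Suc n))"
    by (rule suminf_add[symmetric]) auto
  also have "(\<Sum>n. ennreal (e * (1/2) ^ Suc n)) = ennreal e"
    using e sums_mult[OF power_half_series, of e]
    by (intro suminf_ennreal_eq) auto
  finally show "hausdorff_content \<delta> (\<Union>n. A n) \<le> (\<Sum>n. hausdorff_content \<delta> (A n)) + ennreal e" .
qed

lemma hausdorff_outer_UN_le:
  fixes A :: "nat \<Rightarrow> 'a::metric_space set"
  shows "hausdorff_outer (\<Union>n. A n) \<le> (\<Sum>n. hausdorff_outer (A n))"
  unfolding hausdorff_outer_def[of "\<Union>n. A n"]
proof (rule SUP_least)
  fix \<delta> :: real assume "\<delta> \<in> {0<..}"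
  then have "(\<Sum>n. hausdorff_content \<delta> (A n)) \<le> (\<Sum>n. hausdorff_outer (A n))"
    by (intro suminf_le hausdorff_content_le_outer) auto
  then show "hausdorff_content \<delta> (\<Union>n. A n) \<le> (\<Sum>n. hausdorff_outer (A n))"
    using hausdorff_content_UN_le order_trans by blast
qed

lemma hausdorff_outer_Un_le:
  fixes A B :: "'a::metric_space set"
  shows "hausdorff_outer (A \<union> B) \<le> hausdorff_outer A + hausdorff_outer B"
proof -
  define K where "K = (\<lambda>n::nat. if n = 0 then A else if n = 1 then B else {})"
  have "A \<union> B = (\<Union>n. K n)"
    by (auto simp: K_def split: if_splits)
  then have "hausdorff_outer (A \<union> B) \<le> (\<Sum>n. hausdorff_outer (K n))"
    using hausdorff_outer_UN_le[of K] by simp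
  also have "\<dots> = (\<Sum>n\<in>{0,1}. hausdorff_outer (K n))"
    by (rule suminf_finite) (auto simp: K_def)
  finally show ?thesis by (simp add: K_def)
qed

lemma hausdorff_outer_separated:
  fixes A B :: "'a::metric_space set"
  assumes d: "0 < d" and sep: "\<And>x y. x \<in> A \<Longrightarrow> y \<in> B \<Longrightarrow> d \<le> dist x y"
  shows "hausdorff_outer A + hausdorff_outer B \<le> hausdorff_outer (A \<union> B)"
proof -
  have content: "hausdorff_content \<delta> A + hausdorff_content \<delta> B \<le> hausdorff_outer (A \<union> B)"
    if \<delta>: "0 < \<delta>" "\<delta> < d" for \<delta>
  proof -
    have "hausdorff_content \<delta> A + hausdorff_content \<delta> B \<le> (\<Sum>i. ennreal (diameter (K i)))"
      if K: "K \<in> fine_covers \<delta> (A \<union> B)" for K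
    proof -
      define P where "P = (\<lambda>S i. if K i \<inter> S = {} then {} else K i)"
      have cover: "P S \<in> fine_covers \<delta> S" if "S \<subseteq> A \<union> B" for S
        using K that \<delta> by (auto simp: P_def fine_covers_def) blast
      have disj: "K i \<inter> A = {} \<or> K i \<inter> B = {}" for i
      proof (rule ccontr)
        assume "\<not> ?thesis"
        then obtain x y where xy: "x \<in> K i" "x \<in> A" "y \<in> K i" "y \<in> B" by blast
        then have "dist x y \<le> \<delta>"
          using K diameter_bounded_bound[of "K i" x y]
          unfolding fine_covers_def by (blast intro: order_trans)
        then show False using sep[OF xy(2,4)] \<delta> by simp
      qed
      have "hausdorff_content \<delta> A + hausdorff_content \<delta> B
          \<le> (\<Sum>i. ennreal (diameter (P A i))) + (\<Sum>i. ennreal (diameter (P B i)))"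
        by (intro add_mono hausdorff_content_le cover) auto
      also have "\<dots> = (\<Sum>i. ennreal (diameter (P A i)) + ennreal (diameter (P B i)))"
        by (rule suminf_add) auto
      also have "\<dots> \<le> (\<Sum>i. ennreal (diameter (K i)))"
        using disj by (intro suminf_le) (auto simp: P_def)
      finally show ?thesis .
    qed
    then have "hausdorff_content \<delta> A + hausdorff_content \<delta> B \<le> hausdorff_content \<delta> (A \<union> B)"
      unfolding hausdorff_content_def[of \<delta> "A \<union> B"] by (intro INF_greatest) auto
    then show ?thesis
      using hausdorff_content_le_outer[OF \<delta>(1), of "A \<union> B"] by (rule order_trans)
  qed
  have mixed: "hausdorff_content s A + hausdorff_content t B \<le> hausdorff_outer (A \<union> B)"
    if "0 < s" "0 < t" for s t
  proof -
    define \<delta> where "\<delta> = min (min s t) (d/2)"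
    have \<delta>: "0 < \<delta>" "\<delta> < d" "\<delta> \<le> s" "\<delta> \<le> t" using that d by (auto simp: \<delta>_def)
    have "hausdorff_content s A + hausdorff_content t B
        \<le> hausdorff_content \<delta> A + hausdorff_content \<delta> B"
      by (intro add_mono hausdorff_content_antimono \<delta>)
    then show ?thesis using content[OF \<delta>(1,2)] by (rule order_trans)
  qed
  have "hausdorff_outer A + hausdorff_content t B \<le> hausdorff_outer (A \<union> B)" if "0 < t" for t
  proof -
    have "hausdorff_outer A + hausdorff_content t B
        = (SUP s\<in>{0<..}. hausdorff_content s A + hausdorff_content t B)"
      unfolding hausdorff_outer_def by (rule ennreal_SUP_add_left[symmetric]) auto
    also have "\<dots> \<le> hausdorff_outer (A \<union> B)"
      by (rule SUP_least) (simp add: mixed that)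
    finally show ?thesis .
  qed
  moreover have "hausdorff_outer A + hausdorff_outer B
      = (SUP t\<in>{0<..}. hausdorff_outer A + hausdorff_content t B)"
    unfolding hausdorff_outer_def[of B] by (rule ennreal_SUP_add_right) auto
  ultimately show ?thesis
    by (auto intro: SUP_least)
qed

lemma hausdorff_outer_closed_split:
  fixes A F :: "'a::metric_space set"
  assumes F: "closed F"
  shows "hausdorff_outer (A \<inter> F) + hausdorff_outer (A - F) = hausdorff_outer A"
proof (rule antisym)
  have "hausdorff_outer ((A \<inter> F) \<union> (A - F)) \<le> hausdorff_outer (A \<inter> F) + hausdorff_outer (A - F)"
    by (rule hausdorff_outer_Un_le)
  then show "hausdorff_outer A \<le> hausdorff_outer (A \<inter> F) + hausdorff_outer (A - F)"
    by (simp add: Int_Diff_Un)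
  show "hausdorff_outer (A \<inter> F) + hausdorff_outer (A - F) \<le> hausdorff_outer A"
  proof (cases "F = {} \<or> hausdorff_outer A = top")
    case True
    then show ?thesis by auto
  next
    case False
    then have F_ne: "F \<noteq> {}" and fin: "hausdorff_outer A \<noteq> top" by auto
    define R where "R k = {x\<in>A. 1 / real (k + 2) \<le> infdist x F \<and> infdist x F < 1 / real (k + 1)}"
      for k :: nat
    define Q where "Q n = {x\<in>A. 1 / real (n + 1) \<le> infdist x F}" for n :: nat
    have far: "s - t \<le> dist x y" if "s \<le> infdist x F" "infdist y F \<le> t" for x y s t
      using that infdist_triangle[of x F y] by linarith
    have alternate: "(\<Sum>k<n. hausdorff_outer (R (2*k + j)))
        \<le> hausdorff_outer (\<Union>k<n. R (2*k + j))" for n j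
    proof (induction n)
      case 0
      show ?case by simp
    next
      case (Suc n)
      have "(\<Sum>k<Suc n. hausdorff_outer (R (2*k + j)))
          \<le> hausdorff_outer (\<Union>k<n. R (2*k + j)) + hausdorff_outer (R (2*n + j))"
        using Suc.IH by (simp add: add_right_mono)
      also have "\<dots> \<le> hausdorff_outer ((\<Union>k<n. R (2*k + j)) \<union> R (2*n + j))"
      proof (cases "n = 0")
        case True
        then show ?thesis by simp
      next
        case False
        show ?thesis
        proof (rule hausdorff_outer_separated)
          show "0 < 1 / real (2*n + j) - 1 / real (2*n + j + 1)"
            using False by (simp add: frac_less2)
          fix x y assume "x \<in> (\<Union>k<n. R (2*k + j))" and y: "y \<in> R (2*n + j)"
          then obtain k where k: "k < n" "x \<in> R (2*k + j)" by blast
          have "1 / real (2*n + j) \<le> 1 / real (2*k + j + 2)"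
            using k by (intro divide_left_mono) auto
          also have "\<dots> \<le> infdist x F"
            using k by (simp add: R_def)
          finally show "1 / real (2*n + j) - 1 / real (2*n + j + 1) \<le> dist x y"
            using y by (intro far) (auto simp: R_def)
        qed
      qed
      also have "(\<Union>k<n. R (2*k + j)) \<union> R (2*n + j) = (\<Union>k<Suc n. R (2*k + j))"
        by (auto simp: less_Suc_eq)
      finally show ?case .
    qed
    have half: "(\<Sum>k<n. hausdorff_outer (R (2*k + j))) \<le> hausdorff_outer A" for n j
      using alternate[of j n] by (rule order_trans) (auto intro!: hausdorff_outer_mono simp: R_def)
    have split: "(\<Sum>k<2*n. hausdorff_outer (R k))
        = (\<Sum>k<n. hausdorff_outer (R (2*k + 0))) + (\<Sum>k<n. hausdorff_outer (R (2*k + 1)))" for n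
      by (induction n) (auto simp: algebra_simps)
    define S where "S = (\<Sum>k. hausdorff_outer (R k))"
    have "S \<le> hausdorff_outer A + hausdorff_outer A"
      unfolding S_def suminf_eq_SUP
    proof (rule SUP_least)
      fix n :: nat
      have "(\<Sum>k<n. hausdorff_outer (R k)) \<le> (\<Sum>k<2*n. hausdorff_outer (R k))"
        by (intro sum_mono2) auto
      then show "(\<Sum>k<n. hausdorff_outer (R k)) \<le> hausdorff_outer A + hausdorff_outer A"
        unfolding split using add_mono[OF half[of 0 n] half[of 1 n]] by (rule order_trans)
    qed
    then have S_fin: "S \<noteq> top"
      using fin by (auto simp: top_unique)
    have step: "hausdorff_outer (A \<inter> F) + hausdorff_outer (A - F) + (\<Sum>k<n. hausdorff_outer (R k))
        \<le> hausdorff_outer A + S" for n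
    proof -
      have "A - F \<subseteq> Q n \<union> (\<Union>k. R (k + n))"
      proof
        fix x assume x: "x \<in> A - F"
        then have pos: "0 < infdist x F"
          using F F_ne in_closed_iff_infdist_zero infdist_nonneg[of x F] by (metis DiffD2 less_le)
        show "x \<in> Q n \<union> (\<Union>k. R (k + n))"
        proof (cases "x \<in> Q n")
          case False
          then have lt: "infdist x F < 1 / real (n + 1)" using x by (auto simp: Q_def)
          have ex: "\<exists>m. 1 / real (m + 2) \<le> infdist x F"
          proof -
            obtain m where "inverse (real (Suc m)) < infdist x F"
              using reals_Archimedean[OF pos] by blast
            moreover have "1 / real (m + 2) \<le> inverse (real (Suc m))"
              by (simp add: field_simps)
            ultimately show ?thesis by (intro exI[of _ m]) linarith
          qed
          define m where "m = (LEAST m. 1 / real (m + 2) \<le> infdist x F)"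
          have m: "1 / real (m + 2) \<le> infdist x F"
            unfolding m_def using ex by (rule LeastI_ex)
          have nm: "n \<le> m"
          proof (rule ccontr)
            assume "\<not> n \<le> m"
            then have "1 / real (n + 1) \<le> 1 / real (m + 2)"
              by (intro divide_left_mono) auto
            then show False using m lt by linarith
          qed
          have "infdist x F < 1 / real (m + 1)"
          proof (cases m)
            case 0
            then show ?thesis using nm lt by simp
          next
            case (Suc l)
            then have "\<not> 1 / real (l + 2) \<le> infdist x F"
              using not_less_Least[of l "\<lambda>m. 1 / real (m + 2) \<le> infdist x F"] by (simp add: m_def)
            then show ?thesis using Suc by simp
          qed
          then have "x \<in> R ((m - n) + n)" using m nm x by (simp add: R_def)
          then show ?thesis by blast
        qed simp
      qed
      then have "hausdorff_outer (A - F) \<le> hausdorff_outer (Q n \<union> (\<Union>k. R (k + n)))"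
        by (rule hausdorff_outer_mono)
      also have "\<dots> \<le> hausdorff_outer (Q n) + hausdorff_outer (\<Union>k. R (k + n))"
        by (rule hausdorff_outer_Un_le)
      also have "\<dots> \<le> hausdorff_outer (Q n) + (\<Sum>k. hausdorff_outer (R (k + n)))"
        by (intro add_left_mono hausdorff_outer_UN_le)
      finally have tail: "hausdorff_outer (A - F)
          \<le> hausdorff_outer (Q n) + (\<Sum>k. hausdorff_outer (R (k + n)))" .
      have "hausdorff_outer (A \<inter> F) + hausdorff_outer (Q n) \<le> hausdorff_outer ((A \<inter> F) \<union> Q n)"
      proof (rule hausdorff_outer_separated[of "1 / real (n + 1)"])
        fix x y assume "x \<in> A \<inter> F" "y \<in> Q n"
        then show "1 / real (n + 1) \<le> dist x y"
          using far[of "1 / real (n + 1)" y x 0] by (simp add: Q_def dist_commute)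
      qed simp
      also have "\<dots> \<le> hausdorff_outer A"
        by (rule hausdorff_outer_mono) (auto simp: Q_def)
      finally have main: "hausdorff_outer (A \<inter> F) + hausdorff_outer (Q n) \<le> hausdorff_outer A" .
      have S_split: "S = (\<Sum>k. hausdorff_outer (R (k + n))) + (\<Sum>k<n. hausdorff_outer (R k))"
        unfolding S_def by (rule suminf_offset) auto
      have "hausdorff_outer (A \<inter> F) + hausdorff_outer (A - F) + (\<Sum>k<n. hausdorff_outer (R k))
          \<le> hausdorff_outer (A \<inter> F) + (hausdorff_outer (Q n) + (\<Sum>k. hausdorff_outer (R (k + n))))
            + (\<Sum>k<n. hausdorff_outer (R k))"
        by (intro add_mono tail order_refl)
      also have "\<dots> = (hausdorff_outer (A \<inter> F) + hausdorff_outer (Q n)) + S"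
        by (simp add: S_split ac_simps)
      also have "\<dots> \<le> hausdorff_outer A + S"
        by (intro add_right_mono main)
      finally show ?thesis .
    qed
    have "hausdorff_outer (A \<inter> F) + hausdorff_outer (A - F) + S
        = (SUP n. hausdorff_outer (A \<inter> F) + hausdorff_outer (A - F) + (\<Sum>k<n. hausdorff_outer (R k)))"
      unfolding S_def suminf_eq_SUP by (rule ennreal_SUP_add_right) auto
    also have "\<dots> \<le> hausdorff_outer A + S"
      by (intro SUP_least step)
    finally have "S + (hausdorff_outer (A \<inter> F) + hausdorff_outer (A - F)) \<le> S + hausdorff_outer A"
      by (simp add: ac_simps)
    then show ?thesis
      using S_fin by (simp add: ennreal_add_left_cancel_le)
  qed
qed

lemma measure_space_hausdorff:
  "measure_space UNIV (sets borel) (hausdorff_outer :: 'a::metric_space set \<Rightarrow> ennreal)"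
proof -
  interpret P: sigma_algebra "UNIV :: 'a set" "Pow UNIV" by (rule sigma_algebra_Pow)
  let ?L = "lambda_system (UNIV :: 'a set) (Pow UNIV) hausdorff_outer"
  have "outer_measure_space (Pow UNIV) (hausdorff_outer :: 'a set \<Rightarrow> ennreal)"
    unfolding outer_measure_space_def positive_def increasing_def countably_subadditive_def
    by (auto intro: hausdorff_outer_mono hausdorff_outer_UN_le)
  then have ms: "measure_space UNIV ?L hausdorff_outer"
    by (rule P.caratheodory_lemma)
  then interpret L: sigma_algebra "UNIV :: 'a set" ?L
    by (simp add: measure_space_def)
  have "closed F \<Longrightarrow> F \<in> ?L" for F :: "'a set"
    using hausdorff_outer_closed_split[of F] 
    unfolding P.lambda_system_eq by simp
  then have "sigma_sets UNIV (Collect closed) \<subseteq> ?L"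
    by (intro L.sigma_sets_subset) auto
  then have sub: "sets borel \<subseteq> ?L"
    by (simp add: borel_eq_closed)
  have "countably_additive ?L (hausdorff_outer :: 'a set \<Rightarrow> ennreal)"
    using ms by (simp add: measure_space_def)
  then have "countably_additive (sets borel) (hausdorff_outer :: 'a set \<Rightarrow> ennreal)"
    using sub unfolding countably_additive_def by (meson subset_iff)
  then show ?thesis
    using sets.sigma_algebra_axioms[of "borel :: 'a measure"]
    by (simp add: measure_space_def positive_def)
qed

lemma sets_hausdorff_measure [simp, measurable_cong]: "sets hausdorff_measure = sets borel"
  unfolding hausdorff_measure_def
  using sets.sets_measure_of_eq[of borel] by simp

lemma space_hausdorff_measure [simp]: "space hausdorff_measure = UNIV"
  unfolding hausdorff_measure_def by (simp add: space_measure_of_conv)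

lemma emeasure_hausdorff_measure:
  "A \<in> sets borel \<Longrightarrow> emeasure hausdorff_measure A = hausdorff_outer A"
  using measure_space_hausdorff
  by (intro emeasure_measure_of[OF hausdorff_measure_def]) (auto simp: measure_space_def)


section \<open>Planar Lipschitz domains\<close>

text \<open>Near each boundary point the domain is the strict epigraph of a Lipschitz function in
  suitable orthonormal coordinates \<open>(y \<bullet> e, y \<bullet> n)\<close>.\<close>

definition lipschitz_boundary :: "(real^2) set \<Rightarrow> bool" where
  "lipschitz_boundary \<Omega> \<longleftrightarrow>
     (\<forall>x\<in>frontier \<Omega>. \<exists>U e n. \<exists>\<phi>::real \<Rightarrow> real. \<exists>L.
        open U \<and> x \<in> U \<and> norm e = 1 \<and> norm n = 1 \<and> e \<bullet> n = 0 \<and>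
        L-lipschitz_on UNIV \<phi> \<and>
        \<Omega> \<inter> U = {y\<in>U. \<phi> (y \<bullet> e) < y \<bullet> n})"

definition bounded_lipschitz_domain :: "(real^2) set \<Rightarrow> bool" where
  "bounded_lipschitz_domain \<Omega> \<longleftrightarrow>
     open \<Omega> \<and> connected \<Omega> \<and> \<Omega> \<noteq> {} \<and> bounded \<Omega> \<and> lipschitz_boundary \<Omega>"

text \<open>The cone with vertex \<open>x\<close>, unit axis \<open>\<nu>\<close>, radius \<open>\<rho>\<close> and opening angle \<open>\<theta>\<close>: the angle between
  \<open>y - x\<close> and \<open>\<nu>\<close> is at most \<open>\<theta> / 2\<close>. Whether it is taken closed or open is immaterial below,
  since \<open>closure \<Omega>\<close> and \<open>- \<Omega>\<close> are closed.\<close>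

definition cone_at :: "real^2 \<Rightarrow> real^2 \<Rightarrow> real \<Rightarrow> real \<Rightarrow> (real^2) set" where
  "cone_at x \<nu> \<rho> \<theta> = {y. norm (y - x) \<le> \<rho> \<and> norm (y - x) * cos (\<theta> / 2) \<le> (y - x) \<bullet> \<nu>}"

definition lipschitz_regularity :: "(real^2) set \<Rightarrow> real \<Rightarrow> real \<Rightarrow> bool" where
  "lipschitz_regularity \<Omega> \<rho> \<theta> \<longleftrightarrow>
     0 < \<rho> \<and> 0 < \<theta> \<and> \<theta> < pi \<and>
     (\<forall>x\<in>frontier \<Omega>. \<exists>\<nu>. norm \<nu> = 1 \<and>
        cone_at x \<nu> \<rho> \<theta> \<subseteq> closure \<Omega> \<and> cone_at x (- \<nu>) \<rho> \<theta> \<subseteq> - \<Omega>)"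


section \<open>Tangential derivatives along a boundary curve\<close>

definition is_unit_tangent :: "(real^2) set \<Rightarrow> real^2 \<Rightarrow> real^2 \<Rightarrow> bool" where
  "is_unit_tangent S x \<tau> \<longleftrightarrow>
     x islimpt S \<and> norm \<tau> = 1 \<and>
     ((\<lambda>y. \<bar>(y - x) \<bullet> \<tau>\<bar> / norm (y - x)) \<longlongrightarrow> 1) (at x within S)"

definition unit_tangent :: "(real^2) set \<Rightarrow> real^2 \<Rightarrow> real^2" where
  "unit_tangent S x = (SOME \<tau>. is_unit_tangent S x \<tau>)"

text \<open>The sign of \<open>\<tau>\<close> is irrelevant: only the norm of the tangential derivative is used. On a
  Lipschitz boundary, for the functions of the next definition, the value \<open>0\<close> is taken only
  by convention on a null set.\<close>

definition tangential_deriv :: "(real^2) set \<Rightarrow> (real^2 \<Rightarrow> real^2) \<Rightarrow> real^2 \<Rightarrow> real^2" where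
  "tangential_deriv S g x =
     (if (\<exists>\<tau>. is_unit_tangent S x \<tau>) \<and>
         (\<exists>d. (g has_derivative (\<lambda>v. (v \<bullet> unit_tangent S x) *\<^sub>R d)) (at x within S))
      then THE d. (g has_derivative (\<lambda>v. (v \<bullet> unit_tangent S x) *\<^sub>R d)) (at x within S)
      else 0)"

definition abs_continuous_on_interval :: "real \<Rightarrow> real \<Rightarrow> (real \<Rightarrow> 'a::metric_space) \<Rightarrow> bool" where
  "abs_continuous_on_interval a b f \<longleftrightarrow>
     (\<forall>\<eta>>0. \<exists>\<delta>>0. \<forall>D. finite D \<and> (\<forall>(s, t)\<in>D. a \<le> s \<and> s \<le> t \<and> t \<le> b) \<and>
        pairwise (\<lambda>(s, t) (s', t'). {s<..<t} \<inter> {s'<..<t'} = {}) D \<and>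
        (\<Sum>(s, t)\<in>D. t - s) < \<delta> \<longrightarrow> (\<Sum>(s, t)\<in>D. dist (f s) (f t)) < \<eta>)"

text \<open>Absolute continuity along the curve. Together with square integrability of the tangential
  derivative this is membership in the Sobolev space \<open>H\<^sup>1\<close> of the curve; without it the almost
  everywhere defined tangential derivative would not control \<open>g\<close>.\<close>

definition abs_continuous_along :: "(real^2) set \<Rightarrow> (real^2 \<Rightarrow> real^2) \<Rightarrow> bool" where
  "abs_continuous_along S g \<longleftrightarrow>
     continuous_on S g \<and>
     (\<forall>\<gamma> L. arc \<gamma> \<and> L-lipschitz_on {0..1} \<gamma> \<and> path_image \<gamma> \<subseteq> S \<longrightarrow>
        abs_continuous_on_interval 0 1 (g \<circ> \<gamma>))"


section \<open>The Ginzburg-Landau equation and energies\<close>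

definition partial :: "2 \<Rightarrow> (real^2 \<Rightarrow> real^2) \<Rightarrow> real^2 \<Rightarrow> real^2" where
  "partial i u x = frechet_derivative u (at x) (axis i 1)"

definition laplacian :: "(real^2 \<Rightarrow> real^2) \<Rightarrow> real^2 \<Rightarrow> real^2" where
  "laplacian u x = (\<Sum>i\<in>UNIV. partial i (partial i u) x)"

definition C2_on :: "(real^2) set \<Rightarrow> (real^2 \<Rightarrow> real^2) \<Rightarrow> bool" where
  "C2_on \<Omega> u \<longleftrightarrow>
     (\<forall>x\<in>\<Omega>. u differentiable at x) \<and>
     (\<forall>i. \<forall>x\<in>\<Omega>. partial i u differentiable at x) \<and>
     (\<forall>i j. continuous_on \<Omega> (partial j (partial i u)))"

definition gl_solution ::
  "real \<Rightarrow> (real^2) set \<Rightarrow> (real^2 \<Rightarrow> real^2) \<Rightarrow> (real^2 \<Rightarrow> real^2) \<Rightarrow> bool" where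
  "gl_solution \<epsilon> \<Omega> g u \<longleftrightarrow>
     C2_on \<Omega> u \<and> continuous_on (closure \<Omega>) u \<and>
     (\<forall>x\<in>\<Omega>. - laplacian u x = (1 / \<epsilon>\<^sup>2 * (1 - (norm (u x))\<^sup>2)) *\<^sub>R u x) \<and>
     (\<forall>x\<in>frontier \<Omega>. u x = g x)"

definition interior_energy :: "real \<Rightarrow> (real^2) set \<Rightarrow> (real^2 \<Rightarrow> real^2) \<Rightarrow> ennreal" where
  "interior_energy \<epsilon> \<Omega> u =
     (\<integral>\<^sup>+x\<in>\<Omega>. ennreal (1 / 2 * (\<Sum>i\<in>UNIV. (norm (partial i u x))\<^sup>2)
                     + 1 / (4 * \<epsilon>\<^sup>2) * (1 - (norm (u x))\<^sup>2)\<^sup>2) \<partial>lborel)"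

definition boundary_energy :: "real \<Rightarrow> (real^2) set \<Rightarrow> (real^2 \<Rightarrow> real^2) \<Rightarrow> ennreal" where
  "boundary_energy \<epsilon> \<Omega> g =
     (\<integral>\<^sup>+x\<in>frontier \<Omega>. ennreal (1 / 2 * (norm (tangential_deriv (frontier \<Omega>) g x))\<^sup>2
                     + 1 / (4 * \<epsilon>\<^sup>2) * (1 - (norm (g x))\<^sup>2)\<^sup>2) \<partial>hausdorff_measure)"

end

theory Submission
  imports Defs
begin

text \<open>
  A real-valued solution that vanishes at one boundary point only and recovers the value \<open>1\<close> within a
  distance of order \<open>\<epsilon>\<close> is provided by a radial solution whose centre lies outside the domain. Let \<open>x0\<close> be a point of \<open>closure \<Omega>\<close> with maximal norm and let \<open>p\<close>
  lie at distance \<open>\<epsilon>\<close> from \<open>x0\<close> on the outer side of the ray through \<open>x0\<close>. Then \<open>\<Omega>\<close> avoids the disc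
  of centre \<open>p\<close> and radius \<open>\<epsilon>\<close>, and \<open>x0\<close> is on its boundary circle. Put \<open>g = u\<close>, with
  \<open>u x = v (\<bar>x - p\<bar> / \<epsilon>) e\<close> for a fixed unit vector \<open>e\<close>, where \<open>v\<close> solves the radial equation
  \<open>v'' + v' / r = v\<^sup>3 - v\<close> for \<open>r > 1\<close> with \<open>v 1 = 0\<close>, and \<open>1 - v\<close> and \<open>v'\<close> decay at least like \<open>r\<^sup>-\<^sup>2\<close>. Then \<open>u\<close> solves the equation
  and vanishes at \<open>x0\<close>, and both energy densities are at most a constant times
  \<open>\<epsilon>\<^sup>-\<^sup>2 (\<epsilon> / \<bar>x - p\<bar>)\<^sup>4\<close>. Integrated over a planar region this is bounded, because a disc of radius
  \<open>n \<epsilon>\<close> has area of order \<open>n\<^sup>2 \<epsilon>\<^sup>2\<close>; over the boundary it is of order \<open>1 / \<epsilon>\<close>, because the part of the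
  boundary in such a disc has length of order \<open>n\<^sup>2 \<epsilon>\<close>.

  The profile. In the variable \<open>t = ln r\<close> the first-order term disappears: the equation becomes
  \<open>V'' = exp (2 t) (V\<^sup>3 - V)\<close>, and since \<open>ln \<bar>x - p\<bar>\<close> is harmonic with gradient of length \<open>1 / \<bar>x - p\<bar>\<close>,
  composing \<open>V\<close> with it solves the planar equation. As \<open>\<Omega>\<close> is bounded, \<open>V\<close> is only needed on
  a finite interval, and it is obtained by monotone iteration (\<open>radial_profile_exists\<close>) from the
  subsolution \<open>tanh ((exp t - 1) / sqrt 2)\<close>. This subsolution forces \<open>V\<close> to approach \<open>1\<close> at a rate that does not
  depend on the interval, and concavity of \<open>V\<close> turns that into a bound on \<open>V'\<close> (\<open>radial_profile\<close>).

  The boundary. For two nearby boundary points neither lies inside the double cone of the other.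
  Splitting the boundary according to the direction of the cone axis into boundedly many
  classes, each class is locally a Lipschitz graph, so the length in a small disc of radius \<open>s\<close> is at most
  \<open>K s\<close> with \<open>K\<close> depending on the opening angle alone (\<open>frontier_hausdorff_ball_le\<close>). At
  distances beyond the cone radius \<open>\<rho>\<close> only the total length \<open>H\<close> is known; there the factor \<open>n\<^sup>2\<close> instead of
  \<open>n\<close> pays for it once \<open>\<epsilon> \<le> 1 / H\<close>, which keeps \<open>H\<close> out of the constant
  (\<open>frontier_hausdorff_growth\<close>).
\<close>

section \<open>A linear two-point boundary value problem\<close>

text \<open>A maximum principle: at a negative minimum, which would be interior, the derivative vanishes and is
  strictly decreasing, so the function would decrease further to the right.\<close>

lemma nonneg_if_concave_where_negative:
  fixes \<phi> \<phi>' \<phi>'' :: "real \<Rightarrow> real"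
  assumes T: "0 < T"
    and cont: "continuous_on {0..T} \<phi>"
    and d1: "\<And>t. 0 < t \<Longrightarrow> t < T \<Longrightarrow> (\<phi> has_real_derivative \<phi>' t) (at t)"
    and d2: "\<And>t. 0 < t \<Longrightarrow> t < T \<Longrightarrow> (\<phi>' has_real_derivative \<phi>'' t) (at t)"
    and neg: "\<And>t. 0 < t \<Longrightarrow> t < T \<Longrightarrow> \<phi> t < 0 \<Longrightarrow> \<phi>'' t < 0"
    and ends: "0 \<le> \<phi> 0" "0 \<le> \<phi> T"
    and t: "t \<in> {0..T}"
  shows "0 \<le> \<phi> t"
proof (rule ccontr)
  assume "\<not> 0 \<le> \<phi> t"
  obtain m where m: "m \<in> {0..T}" "\<And>s. s \<in> {0..T} \<Longrightarrow> \<phi> m \<le> \<phi> s"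
    using continuous_attains_inf[OF compact_Icc _ cont] T by auto
  have "\<phi> m < 0" using m(2)[OF t] \<open>\<not> 0 \<le> \<phi> t\<close> by simp
  then have mi: "0 < m" "m < T" using m(1) ends by (auto simp: less_le)
  have "\<phi>' m = 0"
  proof (rule DERIV_local_min[OF d1[OF mi]])
    show "0 < min m (T - m)" using mi by simp
    show "\<forall>y. \<bar>m - y\<bar> < min m (T - m) \<longrightarrow> \<phi> m \<le> \<phi> y"
      using m(2) by (auto simp: abs_if split: if_splits)
  qed
  then obtain d where d: "0 < d" "\<And>h. 0 < h \<Longrightarrow> h < d \<Longrightarrow> \<phi>' (m + h) < 0"
    using DERIV_neg_dec_right[OF d2[OF mi] neg[OF mi \<open>\<phi> m < 0\<close>]] by auto
  (* a step that stays both in the region of negative derivative and inside the interval *)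
  define h where "h = min (d / 2) ((T - m) / 2)"
  have h: "0 < h" "h < d" "m + h < T" using d mi by (auto simp: h_def min_def field_simps)
  obtain z where z: "m < z" "z < m + h" "\<phi> (m + h) - \<phi> m = (m + h - m) * \<phi>' z"
    using MVT2[of m "m + h" \<phi> \<phi>'] d1 h mi by force
  have "\<phi>' z < 0" using d(2)[of "z - m"] z h by simp
  then have "\<phi> (m + h) < \<phi> m" using z(3) mult_pos_neg[of h "\<phi>' z"] h by simp
  then show False using m(2)[of "m + h"] mi h by simp
qed

text \<open>For the operator \<open>\<kappa>\<^sup>2 \<phi> - \<phi>''\<close>, a subsolution with the smaller right-hand side \<open>g\<close> stays below a
  supersolution with the larger one \<open>f\<close>. This one comparison yields the monotonicity of the
  iteration below and both of its barriers.\<close>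

lemma linear_comparison:
  fixes \<phi> \<psi> f g :: "real \<Rightarrow> real"
  assumes T: "0 < T" and \<kappa>: "0 < \<kappa>"
    and cont: "continuous_on {0..T} \<phi>" "continuous_on {0..T} \<psi>"
    and \<phi>1: "\<And>t. 0 < t \<Longrightarrow> t < T \<Longrightarrow> (\<phi> has_real_derivative \<phi>' t) (at t)"
    and \<phi>2: "\<And>t. 0 < t \<Longrightarrow> t < T \<Longrightarrow> (\<phi>' has_real_derivative \<phi>'' t) (at t)"
    and \<psi>1: "\<And>t. 0 < t \<Longrightarrow> t < T \<Longrightarrow> (\<psi> has_real_derivative \<psi>' t) (at t)"
    and \<psi>2: "\<And>t. 0 < t \<Longrightarrow> t < T \<Longrightarrow> (\<psi>' has_real_derivative \<psi>'' t) (at t)"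
    and super: "\<And>t. 0 < t \<Longrightarrow> t < T \<Longrightarrow> \<phi>'' t \<le> \<kappa>\<^sup>2 * \<phi> t - f t"
    and sub: "\<And>t. 0 < t \<Longrightarrow> t < T \<Longrightarrow> \<kappa>\<^sup>2 * \<psi> t - g t \<le> \<psi>'' t"
    and le: "\<And>t. 0 < t \<Longrightarrow> t < T \<Longrightarrow> g t \<le> f t"
    and ends: "\<psi> 0 \<le> \<phi> 0" "\<psi> T \<le> \<phi> T"
    and t: "t \<in> {0..T}"
  shows "\<psi> t \<le> \<phi> t"
proof -
  have "0 \<le> \<phi> t - \<psi> t"
  proof (rule nonneg_if_concave_where_negative[OF T _ _ _ _ _ _ t, where \<phi> = "\<lambda>t. \<phi> t - \<psi> t"
        and \<phi>' = "\<lambda>t. \<phi>' t - \<psi>' t" and \<phi>'' = "\<lambda>t. \<phi>'' t - \<psi>'' t"])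
    fix t assume t: "0 < t" "t < T"
    show "((\<lambda>t. \<phi> t - \<psi> t) has_real_derivative \<phi>' t - \<psi>' t) (at t)"
      using \<phi>1[OF t] \<psi>1[OF t] by (rule DERIV_diff)
    show "((\<lambda>t. \<phi>' t - \<psi>' t) has_real_derivative \<phi>'' t - \<psi>'' t) (at t)"
      using \<phi>2[OF t] \<psi>2[OF t] by (rule DERIV_diff)
    assume "\<phi> t - \<psi> t < 0"
    then have "\<kappa>\<^sup>2 * (\<phi> t - \<psi> t) < 0" using \<kappa> by (simp add: mult_pos_neg)
    then show "\<phi>'' t - \<psi>'' t < 0"
      using super[OF t] sub[OF t] le[OF t] by (simp add: right_diff_distrib)
  qed (use cont ends in \<open>auto intro: continuous_on_diff\<close>)
  then show ?thesis by simp
qed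

text \<open>Variation of constants: this is the integral of \<open>sinh (\<kappa> (t - s)) / \<kappa> * f s\<close> over \<open>[0, t]\<close>, which solves
  \<open>P'' = \<kappa>\<^sup>2 P + f\<close> with zero initial data. Writing \<open>sinh\<close> through exponentials takes \<open>t\<close> out of
  the integrands.\<close>

definition forced_response :: "real \<Rightarrow> (real \<Rightarrow> real) \<Rightarrow> real \<Rightarrow> real" where
  "forced_response \<kappa> f t =
     (exp (\<kappa> * t) * integral {0..t} (\<lambda>s. exp (- \<kappa> * s) * f s)
      - exp (- \<kappa> * t) * integral {0..t} (\<lambda>s. exp (\<kappa> * s) * f s)) / (2 * \<kappa>)"

definition forced_response' :: "real \<Rightarrow> (real \<Rightarrow> real) \<Rightarrow> real \<Rightarrow> real" where
  "forced_response' \<kappa> f t =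
     (exp (\<kappa> * t) * integral {0..t} (\<lambda>s. exp (- \<kappa> * s) * f s)
      + exp (- \<kappa> * t) * integral {0..t} (\<lambda>s. exp (\<kappa> * s) * f s)) / 2"

text \<open>The solution of \<open>\<kappa>\<^sup>2 \<phi> - \<phi>'' = f\<close> with \<open>\<phi> 0 = 0\<close> and \<open>\<phi> T = 1\<close>, as an explicit integral operator in \<open>f\<close>.
  The explicit form still makes sense when \<open>f\<close> is a mere pointwise limit of continuous functions.\<close>

definition dirichlet_solution :: "real \<Rightarrow> real \<Rightarrow> (real \<Rightarrow> real) \<Rightarrow> real \<Rightarrow> real" where
  "dirichlet_solution \<kappa> T f t =
     (1 + forced_response \<kappa> f T) / sinh (\<kappa> * T) * sinh (\<kappa> * t) - forced_response \<kappa> f t"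

definition dirichlet_solution' :: "real \<Rightarrow> real \<Rightarrow> (real \<Rightarrow> real) \<Rightarrow> real \<Rightarrow> real" where
  "dirichlet_solution' \<kappa> T f t =
     (1 + forced_response \<kappa> f T) / sinh (\<kappa> * T) * (\<kappa> * cosh (\<kappa> * t)) - forced_response' \<kappa> f t"

lemma integral_upto_has_derivative:
  fixes h :: "real \<Rightarrow> real"
  assumes "continuous_on {0..T} h" "0 < t" "t < T"
  shows "((\<lambda>t. integral {0..t} h) has_real_derivative h t) (at t)"
proof -
  have "((\<lambda>t. integral {0..t} h) has_vector_derivative h t) (at t within {0..T})"
    by (rule integral_has_vector_derivative) (use assms in auto)
  then show ?thesis
    using assms by (simp add: has_real_derivative_iff_has_vector_derivative at_within_Icc_at)
qed

context
  fixes \<kappa> T :: real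
  assumes \<kappa>: "0 < \<kappa>" and T: "0 < T"
begin

lemma dirichlet_solution_0: "dirichlet_solution \<kappa> T f 0 = 0"
  by (simp add: dirichlet_solution_def forced_response_def)

lemma dirichlet_solution_T: "dirichlet_solution \<kappa> T f T = 1"
  using \<kappa> T by (simp add: dirichlet_solution_def)

lemma dirichlet_solution_continuous:
  assumes "\<And>c. (\<lambda>s. exp (c * s) * f s) integrable_on {0..T}"
  shows "continuous_on {0..T} (dirichlet_solution \<kappa> T f)"
  unfolding dirichlet_solution_def[abs_def] forced_response_def[abs_def]
  by (intro continuous_intros indefinite_integral_continuous_1 assms) (use \<kappa> T in auto)

lemma dirichlet_solution_derivs:
  assumes f: "continuous_on {0..T} f" and t: "0 < t" "t < T"
  shows "(dirichlet_solution \<kappa> T f has_real_derivative dirichlet_solution' \<kappa> T f t) (at t)"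
    and "(dirichlet_solution' \<kappa> T f has_real_derivative \<kappa>\<^sup>2 * dirichlet_solution \<kappa> T f t - f t) (at t)"
proof -
  have I: "((\<lambda>t. integral {0..t} (\<lambda>s. exp (c * s) * f s)) has_real_derivative exp (c * t) * f t) (at t)" for c
    by (rule integral_upto_has_derivative[OF _ t]) (intro continuous_intros f)
  define A where "A = (\<lambda>t. integral {0..t} (\<lambda>s. exp (- \<kappa> * s) * f s))"
  define B where "B = (\<lambda>t. integral {0..t} (\<lambda>s. exp (\<kappa> * s) * f s))"
  have A: "(A has_real_derivative exp (- \<kappa> * t) * f t) (at t)"
    and B: "(B has_real_derivative exp (\<kappa> * t) * f t) (at t)"
    unfolding A_def B_def by (rule I)+
  have E: "exp (\<kappa> * t) * (exp (- \<kappa> * t) * f t) = f t" "exp (- \<kappa> * t) * (exp (\<kappa> * t) * f t) = f t"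
    by (simp_all add: exp_minus)
  have P: "forced_response \<kappa> f = (\<lambda>t. (exp (\<kappa> * t) * A t - exp (- \<kappa> * t) * B t) * (1 / (2 * \<kappa>)))"
    and P': "forced_response' \<kappa> f = (\<lambda>t. (exp (\<kappa> * t) * A t + exp (- \<kappa> * t) * B t) * (1 / 2))"
    by (auto simp: fun_eq_iff forced_response_def forced_response'_def A_def B_def)
  have e1: "((\<lambda>t. exp (\<kappa> * t) * A t) has_real_derivative \<kappa> * exp (\<kappa> * t) * A t + f t) (at t)"
    by (rule derivative_eq_intros A refl)+ (use E in \<open>simp add: mult_ac\<close>)
  have e2: "((\<lambda>t. exp (- \<kappa> * t) * B t) has_real_derivative - \<kappa> * exp (- \<kappa> * t) * B t + f t) (at t)"
    by (rule derivative_eq_intros B refl)+ (use E in \<open>simp add: mult_ac\<close>)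
  have d1: "(forced_response \<kappa> f has_real_derivative forced_response' \<kappa> f t) (at t)"
    unfolding P P' by (rule DERIV_cong[OF DERIV_cmult_right[OF DERIV_diff[OF e1 e2]]])
      (use \<kappa> in \<open>simp add: field_simps\<close>)
  have d2: "(forced_response' \<kappa> f has_real_derivative \<kappa>\<^sup>2 * forced_response \<kappa> f t + f t) (at t)"
    unfolding P P' by (rule DERIV_cong[OF DERIV_cmult_right[OF DERIV_add[OF e1 e2]]])
      (use \<kappa> in \<open>simp add: field_simps power2_eq_square\<close>)
  have s: "((\<lambda>t. sinh (\<kappa> * t)) has_real_derivative \<kappa> * cosh (\<kappa> * t)) (at t)"
    and c: "((\<lambda>t. \<kappa> * cosh (\<kappa> * t)) has_real_derivative \<kappa>\<^sup>2 * sinh (\<kappa> * t)) (at t)"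
    by (auto intro!: derivative_eq_intros simp: power2_eq_square)
  show "(dirichlet_solution \<kappa> T f has_real_derivative dirichlet_solution' \<kappa> T f t) (at t)"
    unfolding dirichlet_solution_def[abs_def] dirichlet_solution'_def
    by (intro DERIV_diff DERIV_cmult s d1)
  show "(dirichlet_solution' \<kappa> T f has_real_derivative \<kappa>\<^sup>2 * dirichlet_solution \<kappa> T f t - f t) (at t)"
    unfolding dirichlet_solution_def dirichlet_solution'_def[abs_def]
    by (rule DERIV_cong[OF DERIV_diff[OF DERIV_cmult[OF c] d2]]) (simp add: algebra_simps)
qed

text \<open>Dominated convergence. It lets a bounded pointwise limit of iterates pass through the solution
  operator before anything is known about the continuity of the limit.\<close>

lemma dirichlet_solution_limit:
  fixes f :: "nat \<Rightarrow> real \<Rightarrow> real"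
  assumes cont: "\<And>n. continuous_on {0..T} (f n)"
    and bound: "\<And>n s. s \<in> {0..T} \<Longrightarrow> \<bar>f n s\<bar> \<le> M"
    and lim: "\<And>s. s \<in> {0..T} \<Longrightarrow> (\<lambda>n. f n s) \<longlonglongrightarrow> g s"
  shows "(\<lambda>s. exp (c * s) * g s) integrable_on {0..T}"
    and "t \<in> {0..T} \<Longrightarrow> (\<lambda>n. dirichlet_solution \<kappa> T (f n) t) \<longlonglongrightarrow> dirichlet_solution \<kappa> T g t"
proof -
  have D: "(\<lambda>s. exp (c * s) * g s) integrable_on {0..r} \<and>
      (\<lambda>n. integral {0..r} (\<lambda>s. exp (c * s) * f n s)) \<longlonglongrightarrow> integral {0..r} (\<lambda>s. exp (c * s) * g s)"
    if r: "r \<in> {0..T}" for c r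
  proof -
    have i1: "(\<lambda>s. exp (c * s) * f n s) integrable_on {0..r}" for n
      by (intro integrable_continuous_real continuous_intros continuous_on_subset[OF cont]) (use r in auto)
    have i2: "(\<lambda>s. exp (c * s) * M) integrable_on {0..r}"
      by (intro integrable_continuous_real continuous_intros)
    have i3: "norm (exp (c * s) * f n s) \<le> exp (c * s) * M" if "s \<in> {0..r}" for n s
      using bound[of s n] that r by (simp add: abs_mult)
    have i4: "(\<lambda>n. exp (c * s) * f n s) \<longlonglongrightarrow> exp (c * s) * g s" if "s \<in> {0..r}" for s
      by (intro tendsto_intros lim) (use that r in auto)
    show ?thesis
      using dominated_convergence[OF i1 i2 i3 i4] by blast
  qed
  show "(\<lambda>s. exp (c * s) * g s) integrable_on {0..T}"
    using D[of T] T by simp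
  have P: "(\<lambda>n. forced_response \<kappa> (f n) r) \<longlonglongrightarrow> forced_response \<kappa> g r" if "r \<in> {0..T}" for r
    unfolding forced_response_def
    by (intro tendsto_intros conjunct2[OF D[OF that]]) (use \<kappa> in auto)
  show "(\<lambda>n. dirichlet_solution \<kappa> T (f n) t) \<longlonglongrightarrow> dirichlet_solution \<kappa> T g t" if "t \<in> {0..T}"
    unfolding dirichlet_solution_def using P[OF that] P[of T] T \<kappa> by (intro tendsto_intros) auto
qed

end

section \<open>The radial profile in logarithmic coordinates\<close>

text \<open>The equation \<open>V'' = exp (2 t) (V\<^sup>3 - V)\<close> is rewritten as \<open>\<kappa>\<^sup>2 V - V'' = shifted_rhs \<kappa> t V\<close>; the shift by
  \<open>\<kappa>\<^sup>2 V\<close> makes the right-hand side increasing in \<open>V\<close>.\<close>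

definition shifted_rhs :: "real \<Rightarrow> real \<Rightarrow> real \<Rightarrow> real" where
  "shifted_rhs \<kappa> t v = \<kappa>\<^sup>2 * v + exp (2 * t) * (v - v ^ 3)"

lemma shifted_rhs_mono:
  assumes "2 * exp T \<le> \<kappa>" "t \<le> T" "0 \<le> a" "a \<le> b" "b \<le> 1"
  shows "shifted_rhs \<kappa> t a \<le> shifted_rhs \<kappa> t b"
proof -
  have "(2 * exp T)\<^sup>2 \<le> \<kappa>\<^sup>2" using assms by (intro power_mono) auto
  moreover have "exp (2 * t) \<le> exp (2 * T)" using assms by simp
  moreover have "(exp T)\<^sup>2 = exp (2 * T)" by (simp add: exp_double)
  ultimately have \<kappa>: "4 * exp (2 * t) \<le> \<kappa>\<^sup>2" by (simp add: power_mult_distrib del: exp_le_cancel_iff)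
  have "a\<^sup>2 + a * b + b\<^sup>2 \<le> 1 + 1 + 1"
    using assms by (intro add_mono power_le_one mult_le_one) auto
  then have "exp (2 * t) * (a\<^sup>2 + a * b + b\<^sup>2 - 1) \<le> exp (2 * t) * 2"
    by (intro mult_left_mono) auto
  then have "0 \<le> (b - a) * (\<kappa>\<^sup>2 - exp (2 * t) * (a\<^sup>2 + a * b + b\<^sup>2 - 1))"
    using \<kappa> assms exp_gt_zero[of "2 * t"] by (intro mult_nonneg_nonneg) linarith+
  also have "\<dots> = shifted_rhs \<kappa> t b - shifted_rhs \<kappa> t a"
    by (simp add: shifted_rhs_def algebra_simps power2_eq_square power3_eq_cube)
  finally show ?thesis by simp
qed

text \<open>The one-dimensional transition \<open>tanh (s / sqrt 2)\<close>, in the distance \<open>s = r - 1\<close> from the unit circle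
  with \<open>r = exp t\<close>. It solves \<open>k'' = k\<^sup>3 - k\<close> in \<open>s\<close>; as it is increasing, the additional radial term \<open>k' / r\<close> is
  nonnegative, so it is a subsolution of the radial equation.\<close>

definition kink :: "real \<Rightarrow> real" where
  "kink t = tanh ((exp t - 1) / sqrt 2)"

lemma kink_0 [simp]: "kink 0 = 0" by (simp add: kink_def)
lemma kink_less_1: "kink t < 1" by (simp add: kink_def tanh_real_lt_1)
lemma kink_nonneg: "0 \<le> t \<Longrightarrow> 0 \<le> kink t" by (simp add: kink_def)

lemma kink_derivs:
  "(kink has_real_derivative (1 - (kink t)\<^sup>2) * (exp t / sqrt 2)) (at t)"
  "((\<lambda>t. (1 - (kink t)\<^sup>2) * (exp t / sqrt 2)) has_real_derivative
      (1 - (kink t)\<^sup>2) * (exp t / sqrt 2) + exp (2 * t) * (kink t ^ 3 - kink t)) (at t)"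
proof -
  show d: "(kink has_real_derivative (1 - (kink t)\<^sup>2) * (exp t / sqrt 2)) (at t)" for t
  proof -
    have "((\<lambda>t. (exp t - 1) / sqrt 2) has_real_derivative exp t / sqrt 2) (at t)"
      by (rule DERIV_cong[OF DERIV_cdivide[OF DERIV_diff[OF DERIV_exp DERIV_const]]]) simp
    then show ?thesis
      unfolding kink_def
      by (intro DERIV_chain2[where f = tanh] DERIV_cong[OF has_field_derivative_tanh[OF _ DERIV_ident]])
        simp_all
  qed
  define q where "q = exp t / sqrt 2"
  have q: "((\<lambda>t. exp t / sqrt 2) has_real_derivative q) (at t)"
    unfolding q_def by (intro DERIV_cdivide DERIV_exp)
  have qq: "2 * (q * q) = exp (2 * t)"
    by (simp add: q_def exp_double power2_eq_square)
  have "((\<lambda>t. (1 - (kink t)\<^sup>2) * (exp t / sqrt 2)) has_real_derivative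
      - (2 * kink t * ((1 - (kink t)\<^sup>2) * q)) * q + (1 - (kink t)\<^sup>2) * q) (at t)"
    by (rule derivative_eq_intros d q refl)+ (simp add: q_def)
  also have "- (2 * kink t * ((1 - (kink t)\<^sup>2) * q)) * q = 2 * (q * q) * (kink t ^ 3 - kink t)"
    by (simp add: algebra_simps power2_eq_square power3_eq_cube)
  finally show "((\<lambda>t. (1 - (kink t)\<^sup>2) * (exp t / sqrt 2)) has_real_derivative
      (1 - (kink t)\<^sup>2) * (exp t / sqrt 2) + exp (2 * t) * (kink t ^ 3 - kink t)) (at t)"
    unfolding qq by (simp add: q_def add.commute)
qed

lemma one_minus_kink_le:
  assumes "0 \<le> t"
  shows "1 - kink t \<le> 12 * exp (- 2 * t)"
proof -
  define y where "y = (exp t - 1) / sqrt 2"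
  have "1 - tanh y = 2 * exp (- 2 * y) / (1 + exp (- 2 * y))"
  proof -
    have "1 + exp (- 2 * y) \<noteq> 0" using exp_gt_zero[of "- 2 * y"] by linarith
    then show ?thesis by (simp add: tanh_real_altdef field_simps)
  qed
  also have "\<dots> \<le> 2 * exp (- 2 * y)"
    by (simp add: divide_le_eq add_pos_pos)
  (* replacing sqrt 2 by 1 loses only in the rate and leaves clean exponents *)
  also have "2 * y = sqrt 2 * (exp t - 1)"
    by (simp add: y_def real_div_sqrt field_simps)
  then have "2 * exp (- 2 * y) \<le> 2 * exp (1 - exp t)"
    using assms mult_right_mono[of 1 "sqrt 2" "exp t - 1"] by simp
  also have "\<dots> = 2 * exp 1 / exp (exp t)" by (simp add: exp_diff)
  also have "\<dots> \<le> 2 * exp 1 / ((exp t)\<^sup>2 / 2)"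
  proof (intro divide_left_mono)
    show "(exp t)\<^sup>2 / 2 \<le> exp (exp t)"
      using exp_lower_Taylor_quadratic[of "exp t"] exp_gt_zero[of t] by linarith
  qed auto
  also have "\<dots> = 4 * exp 1 * exp (- 2 * t)"
    using exp_double[of t] by (simp add: field_simps exp_minus)
  also have "\<dots> \<le> 12 * exp (- 2 * t)" using exp_le by simp
  finally show ?thesis by (simp add: kink_def y_def)
qed


text \<open>Monotone iteration: the solution operator applied to the shifted right-hand side preserves
  order and maps functions between \<open>kink\<close> and \<open>1\<close> to such functions, so iterating it from \<open>kink\<close>
  produces an increasing bounded sequence. Its pointwise limit is a fixed point by dominated
  convergence, hence continuous, hence a classical solution.\<close>

lemma radial_profile_exists:
  assumes T: "0 < T"
  obtains V V' :: "real \<Rightarrow> real" where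
    "continuous_on {0..T} V" "V 0 = 0" "V T = 1"
    "\<And>t. t \<in> {0..T} \<Longrightarrow> kink t \<le> V t \<and> V t \<le> 1"
    "\<And>t. 0 < t \<Longrightarrow> t < T \<Longrightarrow> (V has_real_derivative V' t) (at t)"
    "\<And>t. 0 < t \<Longrightarrow> t < T \<Longrightarrow> (V' has_real_derivative exp (2 * t) * (V t ^ 3 - V t)) (at t)"
proof -
  (* the derivative of v - v^3 is at least -2 on [0, 1], so \<kappa>\<^sup>2 has to exceed 2 exp (2 T) *)
  define \<kappa> where "\<kappa> = 2 * exp T"
  have \<kappa>: "0 < \<kappa>" "2 * exp T \<le> \<kappa>" by (simp_all add: \<kappa>_def)
  note G_0 = dirichlet_solution_0[OF \<kappa>(1) T] and G_T = dirichlet_solution_T[OF \<kappa>(1) T]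
    and G_d = dirichlet_solution_derivs[OF \<kappa>(1) T]
  define F where "F v t = shifted_rhs \<kappa> t (v t)" for v :: "real \<Rightarrow> real" and t
  define G where "G v = dirichlet_solution \<kappa> T (F v)" for v
  have F_cont: "continuous_on {0..T} (F v)" if "continuous_on {0..T} v" for v
    unfolding F_def[abs_def] shifted_rhs_def by (intro continuous_intros that)
  define adm where "adm v \<longleftrightarrow> continuous_on {0..T} v \<and> (\<forall>t\<in>{0..T}. kink t \<le> v t \<and> v t \<le> 1)" for v
  have F_mono: "F v t \<le> F w t" if "t \<in> {0..T}" "0 \<le> v t" "v t \<le> w t" "w t \<le> 1" for v w t
    unfolding F_def using that by (intro shifted_rhs_mono[OF \<kappa>(2)]) auto
  have F_1: "F (\<lambda>_. 1) t = \<kappa>\<^sup>2" for t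
    by (simp add: F_def shifted_rhs_def)
  have adm0: "0 \<le> v t" if "adm v" "t \<in> {0..T}" for v t
    using that kink_nonneg[of t] unfolding adm_def by (meson atLeastAtMost_iff order_trans)
  have G_cont: "continuous_on {0..T} (G v)" if "continuous_on {0..T} v" for v
    unfolding G_def
    by (intro dirichlet_solution_continuous[OF \<kappa>(1) T] integrable_continuous_real continuous_intros F_cont that)
  have kink_cont: "continuous_on A kink" for A
    using kink_derivs(1) by (meson DERIV_isCont continuous_at_imp_continuous_on)
  have G_adm: "adm (G v)" if v: "adm v" for v
    unfolding adm_def
  proof (intro conjI ballI)
    have vc: "continuous_on {0..T} v" using v by (simp add: adm_def)
    show "continuous_on {0..T} (G v)" by (rule G_cont[OF vc])
    note G_d' = G_d[OF F_cont[OF vc], folded G_def]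
    fix t assume t: "t \<in> {0..T}"
    show "kink t \<le> G v t"
    proof (rule linear_comparison[OF T \<kappa>(1) G_cont[OF vc] kink_cont G_d' kink_derivs order_refl _ _ _ _ t])
      fix t assume "0 < t" "t < T"
      then show "F kink t \<le> F v t"
        using v kink_nonneg by (intro F_mono) (auto simp: adm_def)
      show "\<kappa>\<^sup>2 * kink t - F kink t
          \<le> (1 - (kink t)\<^sup>2) * (exp t / sqrt 2) + exp (2 * t) * (kink t ^ 3 - kink t)"
      proof -
        have "(kink t)\<^sup>2 \<le> 1"
          using kink_nonneg[of t] less_imp_le[OF kink_less_1] \<open>0 < t\<close> by (intro power_le_one) auto
        then have "0 \<le> (1 - (kink t)\<^sup>2) * (exp t / sqrt 2)" by (intro mult_nonneg_nonneg) auto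
        then show ?thesis by (simp add: F_def shifted_rhs_def right_diff_distrib)
      qed
    qed (use kink_less_1[of T] in \<open>simp_all add: G_def G_0 G_T\<close>)
    show "G v t \<le> 1"
    proof (rule linear_comparison[OF T \<kappa>(1) continuous_on_const G_cont[OF vc] DERIV_const DERIV_const
          G_d' _ order_refl _ _ _ t])
      fix t assume t: "0 < t" "t < T"
      then show "F v t \<le> F (\<lambda>_. 1) t"
        using v adm0[OF v, of t] by (intro F_mono) (auto simp: adm_def)
    qed (simp_all add: G_def G_0 G_T F_1)
  qed
  have G_mono: "G v t \<le> G w t" if v: "adm v" and w: "adm w"
    and le: "\<And>t. t \<in> {0..T} \<Longrightarrow> v t \<le> w t" and t: "t \<in> {0..T}" for v w t
  proof -
    have vc: "continuous_on {0..T} v" "continuous_on {0..T} w" using v w by (simp_all add: adm_def)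
    show ?thesis
    proof (rule linear_comparison[OF T \<kappa>(1) G_cont[OF vc(2)] G_cont[OF vc(1)]
          G_d[OF F_cont[OF vc(2)], folded G_def] G_d[OF F_cont[OF vc(1)], folded G_def]
          order_refl order_refl _ _ _ t])
      fix t assume "0 < t" "t < T"
      then show "F v t \<le> F w t"
        using w le adm0[OF v, of t] by (intro F_mono) (auto simp: adm_def)
    qed (simp_all add: G_def G_0 G_T)
  qed
  define vs where "vs n = (G ^^ n) kink" for n :: nat
  have vs_Suc: "vs (Suc n) = G (vs n)" for n by (simp add: vs_def)
  have vs_adm: "adm (vs n)" for n
  proof (induction n)
    case 0
    show ?case using kink_cont less_imp_le[OF kink_less_1] by (auto simp: vs_def adm_def)
  qed (simp add: vs_Suc G_adm)
  have vs_step: "vs n t \<le> vs (Suc n) t" if "t \<in> {0..T}" for n t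
    using that
  proof (induction n arbitrary: t)
    case 0
    then show ?case using vs_adm[of 1] by (simp add: adm_def vs_def)
  next
    case (Suc n)
    then show ?case using G_mono[OF vs_adm[of n] vs_adm[of "Suc n"]] by (simp add: vs_Suc)
  qed
  have "convergent (\<lambda>n. vs n t)" if t: "t \<in> {0..T}" for t
  proof (rule Bseq_monoseq_convergent)
    show "Bseq (\<lambda>n. vs n t)"
      using adm0[OF vs_adm t] vs_adm t by (intro BseqI'[of _ 1]) (auto simp: adm_def)
    show "monoseq (\<lambda>n. vs n t)"
      using vs_step[OF t] by (simp add: monoseq_Suc)
  qed
  then obtain v where v: "\<And>t. t \<in> {0..T} \<Longrightarrow> (\<lambda>n. vs n t) \<longlonglongrightarrow> v t"
    unfolding convergent_def by metis
  have F_bound: "\<bar>F (vs n) t\<bar> \<le> \<kappa>\<^sup>2" if t: "t \<in> {0..T}" for n t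
  proof -
    have r: "0 \<le> vs n t" "vs n t \<le> 1"
      using adm0[OF vs_adm t] vs_adm[of n] t by (auto simp: adm_def)
    have "F (\<lambda>_. 0) t \<le> F (vs n) t" "F (vs n) t \<le> F (\<lambda>_. 1) t"
      using r t by (auto intro!: F_mono)
    then show ?thesis by (simp add: F_1) (simp add: F_def shifted_rhs_def)
  qed
  have F_lim: "(\<lambda>n. F (vs n) t) \<longlonglongrightarrow> F v t" if "t \<in> {0..T}" for t
    unfolding F_def shifted_rhs_def by (intro tendsto_intros v that)
  note L = dirichlet_solution_limit[OF \<kappa>(1) T F_cont F_bound F_lim]
  have vc': "\<And>n. continuous_on {0..T} (vs n)" using vs_adm by (simp add: adm_def)
  have fix_v: "G v t = v t" if t: "t \<in> {0..T}" for t
  proof -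
    have "(\<lambda>n. vs (Suc n) t) \<longlonglongrightarrow> G v t"
      unfolding vs_Suc G_def by (rule L(2)[OF vc' _ _ t]) auto
    then show ?thesis using LIMSEQ_unique LIMSEQ_Suc[OF v[OF t]] by blast
  qed
  have Gv_cont: "continuous_on {0..T} (G v)"
    unfolding G_def by (rule dirichlet_solution_continuous[OF \<kappa>(1) T]) (rule L(1)[OF vc'], auto)
  then have v_cont: "continuous_on {0..T} v"
    using fix_v by (rule continuous_on_eq)
  note d = G_d[OF F_cont[OF v_cont], folded G_def]
  show thesis
  proof (rule that[OF Gv_cont])
    show "G v 0 = 0" "G v T = 1" by (simp_all add: G_def G_0 G_T)
    show "kink t \<le> G v t \<and> G v t \<le> 1" if t: "t \<in> {0..T}" for t
      unfolding fix_v[OF t]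
      using vs_adm t LIMSEQ_le_const[OF v[OF t]] LIMSEQ_le_const2[OF v[OF t]] by (auto simp: adm_def)
    show "(G v has_real_derivative dirichlet_solution' \<kappa> T (F v) t) (at t)" if "0 < t" "t < T" for t
      by (rule d(1)[OF that])
    show "(dirichlet_solution' \<kappa> T (F v) has_real_derivative exp (2 * t) * (G v t ^ 3 - G v t)) (at t)"
      if "0 < t" "t < T" for t
    proof -
      have "G v t = v t" using that by (intro fix_v) auto
      then show ?thesis
        using d(2)[OF that] by (simp add: F_def shifted_rhs_def right_diff_distrib)
    qed
  qed
qed

text \<open>Bounds that do not depend on \<open>T\<close>. Since \<open>0 \<le> V \<le> 1\<close>, the profile is concave in \<open>t\<close>, so that
  \<open>V' t\<close> is at most the increment of \<open>V\<close> over \<open>[t - 1, t]\<close>, which is at most \<open>1 - V (t - 1)\<close>; the value \<open>V T = 1\<close>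
  makes \<open>V'\<close> nonnegative. For \<open>t < 1\<close> there is no room to the left, and \<open>V' t\<close> is instead compared with \<open>V' 1\<close>
  through the bound on \<open>V''\<close>.\<close>

lemma radial_profile:
  assumes T: "1 < T"
  obtains V V' :: "real \<Rightarrow> real" where
    "continuous_on {0..T} V" "V 0 = 0"
    "\<And>t. t \<in> {0..T} \<Longrightarrow> 0 \<le> V t \<and> V t \<le> 1 \<and> 1 - V t \<le> 12 * exp (- 2 * t)"
    "\<And>t. 0 < t \<Longrightarrow> t < T \<Longrightarrow> (V has_real_derivative V' t) (at t)"
    "\<And>t. 0 < t \<Longrightarrow> t < T \<Longrightarrow> \<bar>V' t\<bar> \<le> 120 * exp (- 2 * t)"
    "\<And>t. 0 < t \<Longrightarrow> t < T \<Longrightarrow> (V' has_real_derivative exp (2 * t) * (V t ^ 3 - V t)) (at t)"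
proof -
  obtain V V' where cont: "continuous_on {0..T} V" and V0: "V 0 = 0" and VT: "V T = 1"
    and k: "\<And>t. t \<in> {0..T} \<Longrightarrow> kink t \<le> V t \<and> V t \<le> 1"
    and d1: "\<And>t. 0 < t \<Longrightarrow> t < T \<Longrightarrow> (V has_real_derivative V' t) (at t)"
    and d2: "\<And>t. 0 < t \<Longrightarrow> t < T \<Longrightarrow> (V' has_real_derivative exp (2 * t) * (V t ^ 3 - V t)) (at t)"
    using radial_profile_exists[of T] T by auto
  have V: "0 \<le> V t" "V t \<le> 1" "1 - V t \<le> 12 * exp (- 2 * t)" if t: "t \<in> {0..T}" for t
    using k[OF t] kink_nonneg[of t] one_minus_kink_le[of t] t by auto
  have V'': "exp (2 * t) * (V t ^ 3 - V t) \<le> 0" "- exp (2 * t) \<le> exp (2 * t) * (V t ^ 3 - V t)"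
    if "0 < t" "t < T" for t
  proof -
    have "V t ^ 3 \<le> V t" using V[of t] that power_decreasing[of 1 3 "V t"] by simp
    moreover have "0 \<le> V t ^ 3" using V[of t] that by simp
    moreover have "V t \<le> 1" using V(2)[of t] that by simp
    ultimately have "V t ^ 3 - V t \<le> 0" "-1 \<le> V t ^ 3 - V t"
      by linarith+
    then show "exp (2 * t) * (V t ^ 3 - V t) \<le> 0" "- exp (2 * t) \<le> exp (2 * t) * (V t ^ 3 - V t)"
      using mult_left_mono[of "-1" "V t ^ 3 - V t" "exp (2 * t)"]
      by (simp_all only: mult_le_0_iff mult_minus1_right exp_ge_zero simp_thms)
  qed
  have mvt: "\<exists>z. s < z \<and> z < t \<and> V t - V s = (t - s) * V' z" if "0 \<le> s" "s < t" "t \<le> T" for s t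
  proof -
    have "\<exists>l z. s < z \<and> z < t \<and> (V has_real_derivative l) (at z) \<and> V t - V s = (t - s) * l"
    proof (rule MVT[OF that(2)])
      show "continuous_on {s..t} V" using that by (intro continuous_on_subset[OF cont]) auto
      show "V differentiable (at x)" if "s < x" "x < t" for x
        using d1[of x] that \<open>0 \<le> s\<close> \<open>t \<le> T\<close> by (meson le_less_trans less_le_trans real_differentiable_def)
    qed
    then obtain l z where z: "s < z" "z < t" "(V has_real_derivative l) (at z)" "V t - V s = (t - s) * l"
      by blast
    then have "l = V' z" using that d1[of z] DERIV_unique by force
    then show ?thesis using z by blast
  qed
  have dec: "V' t \<le> V' s" if "0 < s" "s \<le> t" "t < T" for s t
    using DERIV_nonpos_imp_nonincreasing[of s t V'] that d2 V''(1) by (meson le_less_trans less_le_trans)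
  have pos: "0 \<le> V' t" if "0 < t" "t < T" for t
  proof -
    obtain z where z: "t < z" "z < T" "V T - V t = (T - t) * V' z" using mvt[of t T] \<open>0 < t\<close> \<open>t < T\<close> by force
    then have "0 \<le> (T - t) * V' z" using V(2)[of t] VT that by simp
    then have "0 \<le> V' z" using that by (simp add: zero_le_mult_iff)
    then show ?thesis using dec[of t z] z that by simp
  qed
  have tail: "V' t \<le> 1 - V (t - 1)" if "1 \<le> t" "t < T" for t
  proof -
    obtain z where z: "t - 1 < z" "z < t" "V t - V (t - 1) = V' z" using mvt[of "t - 1" t] \<open>1 \<le> t\<close> \<open>t < T\<close> by force
    then show ?thesis using dec[of z t] V(2)[of t] that by auto
  qed
  have e2: "exp 2 \<le> (9::real)"
    using power_mono[OF exp_le, of 2] by (simp flip: exp_double)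
  have bound: "V' t \<le> 120 * exp (- 2 * t)" if t: "0 < t" "t < T" for t
  proof (cases "t \<le> 1")
    case True
    have V1: "V' 1 \<le> 1" using tail[of 1] T V0 by simp
    have "V' t \<le> 10"
    proof (cases "t = 1")
      case False
      then obtain z where z: "t < z" "z < 1" "V' 1 - V' t = (1 - t) * (exp (2 * z) * (V z ^ 3 - V z))"
        using MVT2[of t 1 V' "\<lambda>z. exp (2 * z) * (V z ^ 3 - V z)"] d2 True T t by force
      have "exp (2 * z) \<le> exp 2" using z by simp
      then have "- 9 \<le> exp (2 * z) * (V z ^ 3 - V z)"
        using V''(2)[of z] z t T e2 by linarith
      then have "(1 - t) * (- 9) \<le> V' 1 - V' t"
        unfolding z(3) using z by (intro mult_left_mono) auto
      then show ?thesis using V1 t by (simp add: algebra_simps)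
    qed (use V1 in simp)
    also have "10 \<le> 120 * exp (- 2::real)"
      using e2 by (simp add: exp_minus field_simps)
    also have "\<dots> \<le> 120 * exp (- 2 * t)" using True by simp
    finally show ?thesis by simp
  next
    case False
    then have "V' t \<le> 12 * exp (- 2 * (t - 1))"
      using tail[of t] V(3)[of "t - 1"] t by simp
    also have "exp (- 2 * (t - 1)) = exp 2 * exp (- 2 * t)"
      by (simp flip: exp_add)
    also have "12 * (exp 2 * exp (- 2 * t)) \<le> 12 * (9 * exp (- 2 * t))"
      using e2 by (intro mult_left_mono mult_right_mono) auto
    also have "\<dots> \<le> 120 * exp (- 2 * t)" by simp
    finally show ?thesis .
  qed
  show thesis
    by (rule that[OF cont V0 _ d1 _ d2]) (use V bound pos in auto)
qed

section \<open>Length of the boundary in small discs\<close>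

text \<open>A set on which a real function \<open>f\<close> has an \<open>L\<close>-Lipschitz inverse is covered efficiently by the preimages of
  \<open>m\<close> equal subintervals of the range of \<open>f\<close>: their diameters add up to \<open>2 L s\<close>, and they are
  arbitrarily fine as \<open>m\<close> grows.\<close>

lemma hausdorff_outer_lipschitz_graph_le:
  fixes S :: "'a::real_normed_vector set" and f :: "'a \<Rightarrow> real"
  assumes L: "0 \<le> L" and s: "0 \<le> s"
    and inv: "\<And>y z. y \<in> S \<Longrightarrow> z \<in> S \<Longrightarrow> dist y z \<le> L * \<bar>f y - f z\<bar>"
    and range: "\<And>y. y \<in> S \<Longrightarrow> \<bar>f y - a\<bar> \<le> s"
  shows "hausdorff_outer S \<le> ennreal (2 * L * s)"
  unfolding hausdorff_outer_def
proof (rule SUP_least)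
  fix \<delta> :: real assume "\<delta> \<in> {0<..}"
  then have \<delta>: "0 < \<delta>" by simp
  obtain m :: nat where m: "2 * L * s / \<delta> < real m" using reals_Archimedean2 by blast
  have m0: "0 < real m"
    using m L s \<delta> by (metis divide_nonneg_pos le_less_trans mult_nonneg_nonneg zero_le_numeral)
  define w where "w = 2 * s / m"
  have w0: "0 \<le> w" using s by (simp add: w_def)
  have Lw: "L * w \<le> \<delta>" using m m0 \<delta> by (simp add: w_def field_simps)
  have mw: "real m * w = 2 * s" using m0 by (simp add: w_def)
  define B where "B i = (if i < m then {y\<in>S. a - s + i * w \<le> f y \<and> f y \<le> a - s + (i + 1) * w} else {})"
    for i :: nat
  have near: "dist y z \<le> L * w" if "y \<in> B i" "z \<in> B i" for i y z
  proof -
    have "y \<in> S" "z \<in> S" "\<bar>f y - f z\<bar> \<le> w"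
      using that by (auto simp: B_def abs_le_iff algebra_simps split: if_splits)
    then show ?thesis using inv[of y z] L by (meson mult_left_mono order_trans)
  qed
  have diam: "diameter (B i) \<le> L * w" for i
    using near w0 L by (intro diameter_le) (auto simp: dist_norm)
  have bdd: "bounded (B i)" for i
  proof (cases "B i = {}")
    case False
    then obtain y where "y \<in> B i" by blast
    then show ?thesis using near unfolding bounded_def by blast
  qed simp
  have cover: "S \<subseteq> (\<Union>i. B i)"
  proof
    fix y assume y: "y \<in> S"
    show "y \<in> (\<Union>i. B i)"
    proof (cases "w = 0")
      case True
      then have "s = 0" using mw by simp
      then have "y \<in> B 0" using True y range[OF y] m0 by (simp add: B_def)
      then show ?thesis by blast
    next
      case False
      then have w: "0 < w" using w0 by simp
      define t where "t = (f y - (a - s)) / w"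
      have fy: "f y = a - s + t * w" using w by (simp add: t_def)
      have "0 \<le> t * w" "t * w \<le> real m * w" using range[OF y] mw fy by auto
      then have t: "0 \<le> t" "t \<le> real m" using w by (auto simp: zero_le_mult_iff)
      define i where "i = (if t = real m then m - 1 else nat \<lfloor>t\<rfloor>)"
      have i: "i < m" "real i \<le> t" "t \<le> real i + 1"
        using t m0 by (auto simp: i_def of_nat_diff nat_less_iff floor_less_iff)
      then have "real i * w \<le> t * w" "t * w \<le> (real i + 1) * w"
        using w by (auto intro!: mult_right_mono)
      then have "y \<in> B i" using i y fy by (simp add: B_def add.commute)
      then show ?thesis by blast
    qed
  qed
  have "B \<in> fine_covers \<delta> S"
    using cover bdd order_trans[OF diam Lw] by (auto simp: fine_covers_def)
  then have "hausdorff_content \<delta> S \<le> (\<Sum>i. ennreal (diameter (B i)))"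
    by (rule hausdorff_content_le)
  also have "\<dots> = (\<Sum>i<m. ennreal (diameter (B i)))"
    by (rule suminf_finite) (auto simp: B_def)
  also have "\<dots> \<le> (\<Sum>i<m. ennreal (L * w))"
    by (intro sum_mono ennreal_leI diam)
  also have "\<dots> = ennreal (2 * L * s)"
    using L w0 mw by (simp add: ennreal_of_nat_eq_real_of_nat mult.left_commute flip: ennreal_mult)
      (simp add: mult_ac)
  finally show "hausdorff_content \<delta> S \<le> ennreal (2 * L * s)" .
qed

lemma hausdorff_outer_UN_finite_le:
  assumes "finite I"
  shows "hausdorff_outer (\<Union>i\<in>I. A i) \<le> (\<Sum>i\<in>I. hausdorff_outer (A i))"
  using assms
proof induction
  case (insert i I)
  then have "hausdorff_outer (\<Union>j\<in>insert i I. A j) \<le> hausdorff_outer (A i) + hausdorff_outer (\<Union>j\<in>I. A j)"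
    using hausdorff_outer_Un_le[of "A i" "\<Union>j\<in>I. A j"] by simp
  also have "\<dots> \<le> hausdorff_outer (A i) + (\<Sum>j\<in>I. hausdorff_outer (A j))"
    by (intro add_left_mono insert.IH)
  finally show ?case using insert by simp
qed simp

lemma cone_at_interiorI:
  assumes "norm (z - y) < \<rho>" "norm (z - y) * cos (\<theta> / 2) < (z - y) \<bullet> \<nu>"
  shows "z \<in> interior (cone_at y \<nu> \<rho> \<theta>)"
proof (rule interiorI)
  show "open {z. norm (z - y) < \<rho> \<and> norm (z - y) * cos (\<theta> / 2) < (z - y) \<bullet> \<nu>}"
    by (intro open_Collect_conj open_Collect_less continuous_intros)
qed (use assms in \<open>auto simp: cone_at_def\<close>)

text \<open>The exterior cone at \<open>z\<close> has interior points arbitrarily close to \<open>z\<close>, and these have a neighbourhood free of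
  \<open>\<Omega>\<close>. So a slit, which has domain on both sides, cannot occur.\<close>

lemma frontier_interior_closure_empty:
  assumes reg: "lipschitz_regularity \<Omega> \<rho> \<theta>" and z: "z \<in> frontier \<Omega>" and "open \<Omega>"
  shows "z \<notin> interior (closure \<Omega>)"
proof
  assume zi: "z \<in> interior (closure \<Omega>)"
  obtain \<nu> where \<nu>: "norm \<nu> = 1" "cone_at z (- \<nu>) \<rho> \<theta> \<subseteq> - \<Omega>"
    using reg z by (auto simp: lipschitz_regularity_def)
  have \<rho>: "0 < \<rho>" "cos (\<theta> / 2) < 1"
    using reg cos_monotone_0_pi[of 0 "\<theta> / 2"] by (auto simp: lipschitz_regularity_def)
  obtain e where e: "0 < e" "ball z e \<subseteq> closure \<Omega>"
    using zi by (meson mem_interior)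
  define t where "t = min e \<rho> / 2"
  have t: "0 < t" "t < e" "t < \<rho>" using e \<rho> by (auto simp: t_def min_def)
  let ?w = "z + t *\<^sub>R (- \<nu>)"
  have "\<nu> \<bullet> \<nu> = 1" using \<nu> by (simp add: dot_square_norm)
  then have "?w \<in> interior (cone_at z (- \<nu>) \<rho> \<theta>)"
    using t \<nu> \<rho> by (intro cone_at_interiorI) auto
  moreover have "interior (cone_at z (- \<nu>) \<rho> \<theta>) \<subseteq> - closure \<Omega>"
    using interior_mono[OF \<nu>(2)] by (simp add: interior_complement)
  moreover have "?w \<in> closure \<Omega>" using e t \<nu> by (auto simp: dist_norm subset_iff)
  ultimately show False by blast
qed

text \<open>The vector \<open>(- e$2, e$1)\<close> is \<open>e\<close> turned by a right angle. A vector away from the axis \<open>e\<close> is controlled by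
  its component along the turned one, by Pythagoras.\<close>

lemma norm_le_normal_component:
  fixes e w :: "real^2"
  assumes e: "norm e = 1" and q: "q < 1" and le: "\<bar>w \<bullet> e\<bar> \<le> q * norm w"
  shows "norm w \<le> \<bar>w \<bullet> vector [- e$2, e$1]\<bar> / sqrt (1 - q\<^sup>2)"
proof -
  have "(norm e)\<^sup>2 = 1" "0 \<le> q * norm w" using assms by auto
  then have e2: "(e$1)\<^sup>2 + (e$2)\<^sup>2 = 1"
    by (simp only: power2_norm_eq_inner) (simp add: inner_vec_def sum_2 power2_eq_square)
  let ?n = "w \<bullet> vector [- e$2, e$1]"
  show ?thesis
  proof (cases "w = 0")
    case False
    then have q0: "0 \<le> q" using \<open>0 \<le> q * norm w\<close> by (simp add: zero_le_mult_iff)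
    have "(norm w)\<^sup>2 = (w \<bullet> w) * ((e$1)\<^sup>2 + (e$2)\<^sup>2)"
      by (simp add: power2_norm_eq_inner e2)
    also have "\<dots> = (w \<bullet> e)\<^sup>2 + ?n\<^sup>2"
      by (simp add: inner_vec_def sum_2 power2_eq_square algebra_simps)
    also have "(w \<bullet> e)\<^sup>2 \<le> (q * norm w)\<^sup>2"
      using le power_mono[OF le, of 2] by simp
    finally have "(norm w)\<^sup>2 * (1 - q\<^sup>2) \<le> ?n\<^sup>2"
      by (simp add: power_mult_distrib algebra_simps)
    then have "sqrt ((norm w)\<^sup>2 * (1 - q\<^sup>2)) \<le> sqrt (?n\<^sup>2)"
      by (rule real_sqrt_le_mono)
    then have "norm w * sqrt (1 - q\<^sup>2) \<le> \<bar>?n\<bar>"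
      by (simp add: real_sqrt_mult)
    moreover have "q\<^sup>2 < 1" using q q0 by (simp add: power_less_one_iff abs_square_less_1)
    ultimately show ?thesis by (simp add: field_simps)
  qed simp
qed

text \<open>No boundary point can lie in the interior of either cone of another one: the interior of the inner cone
  consists of interior points of \<open>closure \<Omega>\<close>, that of the outer cone of exterior points.\<close>

lemma frontier_off_axis:
  assumes reg: "lipschitz_regularity \<Omega> \<rho> \<theta>" and "open \<Omega>"
    and cones: "cone_at y \<nu> \<rho> \<theta> \<subseteq> closure \<Omega>" "cone_at y (- \<nu>) \<rho> \<theta> \<subseteq> - \<Omega>"
    and z: "z \<in> frontier \<Omega>" "dist y z < \<rho>"
  shows "\<bar>(z - y) \<bullet> \<nu>\<bar> \<le> norm (z - y) * cos (\<theta> / 2)"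
proof (rule ccontr)
  assume "\<not> ?thesis"
  moreover have "norm (z - y) < \<rho>" using z by (simp add: dist_norm norm_minus_commute)
  ultimately have "z \<in> interior (cone_at y \<nu> \<rho> \<theta>) \<or> z \<in> interior (cone_at y (- \<nu>) \<rho> \<theta>)"
    using cone_at_interiorI[of z y \<rho> \<theta> \<nu>] cone_at_interiorI[of z y \<rho> \<theta> "- \<nu>"]
    by (auto simp: not_le abs_if split: if_splits)
  moreover have "z \<notin> interior (cone_at y \<nu> \<rho> \<theta>)"
    using interior_mono[OF cones(1)] frontier_interior_closure_empty[OF reg z(1) \<open>open \<Omega>\<close>] by blast
  moreover have "interior (cone_at y (- \<nu>) \<rho> \<theta>) \<subseteq> - closure \<Omega>"
    using interior_mono[OF cones(2)] by (simp add: interior_complement)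
  then have "z \<notin> interior (cone_at y (- \<nu>) \<rho> \<theta>)"
    using z(1) by (auto simp: frontier_def)
  ultimately show False by blast
qed

text \<open>Finitely many unit vectors \<open>e\<close>, their number depending on \<open>\<theta>\<close> only, approximate all cone axes up to
  \<open>\<eta> = (1 - cos (\<theta> / 2)) / 2\<close>. Among boundary points whose axis is close to the same \<open>e\<close>, differences make an
  angle with \<open>e\<close> that is bounded below, so that projecting along \<open>e\<close> has a Lipschitz inverse. The
  condition \<open>2 s < \<rho>\<close> keeps the points within the cone radius of each other.\<close>

lemma frontier_hausdorff_ball_le:
  fixes \<theta> :: real
  assumes \<theta>: "0 < \<theta>" "\<theta> < pi"
  obtains K where "0 < K" "\<And>\<Omega> \<rho> a s. \<lbrakk>open \<Omega>; lipschitz_regularity \<Omega> \<rho> \<theta>; 0 \<le> s; 2 * s < \<rho>\<rbrakk> \<Longrightarrow>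
    hausdorff_outer (frontier \<Omega> \<inter> cball a s) \<le> ennreal (K * s)"
proof -
  define c where "c = cos (\<theta> / 2)"
  define q where "q = (1 + c) / 2"
  have c: "0 < c" "c < 1"
    using \<theta> cos_monotone_0_pi[of 0 "\<theta> / 2"] by (auto simp: c_def intro: cos_gt_zero)
  then have q: "0 \<le> q" "q < 1" by (auto simp: q_def)
  then have q2: "0 < 1 - q\<^sup>2" by (simp add: power_less_one_iff abs_square_less_1)
  define \<eta> where "\<eta> = (1 - c) / 2"
  have \<eta>: "0 < \<eta>" using c by (simp add: \<eta>_def)
  have "\<exists>E. finite E \<and> E \<subseteq> sphere 0 1 \<and> sphere (0::real^2) 1 \<subseteq> (\<Union>e\<in>E. ball e \<eta>)"
    using seq_compact_imp_totally_bounded[OF compact_imp_seq_compact[OF compact_sphere]] \<eta> by blast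
  then obtain E where E: "finite E" "E \<subseteq> sphere 0 1" "sphere (0::real^2) 1 \<subseteq> (\<Union>e\<in>E. ball e \<eta>)" by blast
  define L where "L = 1 / sqrt (1 - q\<^sup>2)"
  have L: "0 < L" using q2 by (simp add: L_def)
  define K where "K = (real (card E) + 1) * (2 * L)"
  have K: "0 < K" using L by (simp add: K_def add_pos_pos)
  show thesis
  proof (rule that[OF K])
    fix \<Omega> :: "(real^2) set" and \<rho> s :: real and a :: "real^2"
    assume op: "open \<Omega>" and reg: "lipschitz_regularity \<Omega> \<rho> \<theta>" and s: "0 \<le> s" "2 * s < \<rho>"
    obtain \<nu> where \<nu>: "\<And>x. x \<in> frontier \<Omega> \<Longrightarrow> norm (\<nu> x) = 1 \<and>
        cone_at x (\<nu> x) \<rho> \<theta> \<subseteq> closure \<Omega> \<and> cone_at x (- \<nu> x) \<rho> \<theta> \<subseteq> - \<Omega>"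
      using reg unfolding lipschitz_regularity_def by metis
    define S where "S e = {y \<in> frontier \<Omega> \<inter> cball a s. \<nu> y \<in> ball e \<eta>}" for e
    have piece: "hausdorff_outer (S e) \<le> ennreal (2 * L * s)" if e: "e \<in> E" for e
    proof -
      define n :: "real^2" where "n = vector [- e$2, e$1]"
      have e1: "norm e = 1" using e E(2) by auto
      then have n1: "norm n = 1"
        by (simp add: n_def norm_vec_def L2_set_def sum_2 add.commute)
      show ?thesis
      proof (rule hausdorff_outer_lipschitz_graph_le[where f = "\<lambda>y. y \<bullet> n" and a = "a \<bullet> n"])
        fix y z assume y: "y \<in> S e" and z: "z \<in> S e"
        let ?w = "z - y"
        have "dist y z \<le> 2 * s"
          using y z dist_triangle2[of y z a] by (auto simp: S_def dist_commute)
        then have "dist y z < \<rho>" using s by simp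
        then have "\<bar>?w \<bullet> \<nu> y\<bar> \<le> norm ?w * c"
          using frontier_off_axis[OF reg op] \<nu>[of y] y z by (auto simp: S_def c_def)
        moreover have "\<bar>?w \<bullet> (e - \<nu> y)\<bar> \<le> norm ?w * \<eta>"
          using y by (intro order_trans[OF Cauchy_Schwarz_ineq2] mult_left_mono)
            (auto simp: S_def dist_norm)
        ultimately have "\<bar>?w \<bullet> e\<bar> \<le> norm ?w * c + norm ?w * \<eta>"
          by (simp add: inner_diff_right)
        also have "\<dots> = q * norm ?w" by (simp add: q_def \<eta>_def field_simps)
        finally have "norm ?w \<le> \<bar>?w \<bullet> n\<bar> / sqrt (1 - q\<^sup>2)"
          unfolding n_def by (rule norm_le_normal_component[OF e1 q(2)])
        then show "dist y z \<le> L * \<bar>y \<bullet> n - z \<bullet> n\<bar>"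
          by (simp add: L_def dist_norm norm_minus_commute inner_diff_left abs_minus_commute)
      next
        fix y assume "y \<in> S e"
        then have "norm (y - a) \<le> s" by (simp add: S_def dist_norm norm_minus_commute)
        then show "\<bar>y \<bullet> n - a \<bullet> n\<bar> \<le> s"
          using Cauchy_Schwarz_ineq2[of "y - a" n] n1 by (simp add: inner_diff_left)
      qed (use L s in auto)
    qed
    have "frontier \<Omega> \<inter> cball a s \<subseteq> (\<Union>e\<in>E. S e)"
    proof
      fix y assume y: "y \<in> frontier \<Omega> \<inter> cball a s"
      then have "\<nu> y \<in> sphere 0 1" using \<nu> by auto
      then show "y \<in> (\<Union>e\<in>E. S e)" using E(3) y unfolding S_def by blast
    qed
    then have "hausdorff_outer (frontier \<Omega> \<inter> cball a s) \<le> hausdorff_outer (\<Union>e\<in>E. S e)"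
      by (rule hausdorff_outer_mono)
    also have "\<dots> \<le> (\<Sum>e\<in>E. hausdorff_outer (S e))"
      by (rule hausdorff_outer_UN_finite_le[OF E(1)])
    also have "\<dots> \<le> (\<Sum>e\<in>E. ennreal (2 * L * s))"
      by (intro sum_mono piece)
    also have "\<dots> = ennreal (real (card E) * (2 * L * s))"
      using L s by (simp add: ennreal_of_nat_eq_real_of_nat flip: ennreal_mult)
    also have "\<dots> \<le> ennreal (K * s)"
      using L s by (intro ennreal_leI) (simp add: K_def algebra_simps)
    finally show "hausdorff_outer (frontier \<Omega> \<inter> cball a s) \<le> ennreal (K * s)" .
  qed
qed

lemma frontier_hausdorff_finite:
  assumes "open \<Omega>" "bounded \<Omega>" and reg: "lipschitz_regularity \<Omega> \<rho> \<theta>"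
  shows "hausdorff_outer (frontier \<Omega>) < \<infinity>"
proof -
  have \<rho>: "0 < \<rho>" "0 < \<theta>" "\<theta> < pi" using reg by (auto simp: lipschitz_regularity_def)
  obtain K where K: "\<And>a. hausdorff_outer (frontier \<Omega> \<inter> cball a (\<rho> / 3)) \<le> ennreal (K * (\<rho> / 3))"
  proof (rule frontier_hausdorff_ball_le[OF \<rho>(2,3)])
    fix K
    assume "\<And>\<Omega> \<rho> a s. \<lbrakk>open \<Omega>; lipschitz_regularity \<Omega> \<rho> \<theta>; 0 \<le> s; 2 * s < \<rho>\<rbrakk> \<Longrightarrow>
      hausdorff_outer (frontier \<Omega> \<inter> cball a s) \<le> ennreal (K * s)"
    from this[OF \<open>open \<Omega>\<close> reg, of "\<rho> / 3"] show thesis using \<rho> that by auto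
  qed
  have "compact (frontier \<Omega>)" using \<open>bounded \<Omega>\<close> by (rule compact_frontier_bounded)
  from seq_compact_imp_totally_bounded[OF compact_imp_seq_compact[OF this]] \<rho>
  obtain A where A: "finite A" "frontier \<Omega> \<subseteq> (\<Union>a\<in>A. ball a (\<rho> / 3))"
    by (auto dest!: spec[of _ "\<rho> / 3"])
  have "hausdorff_outer (frontier \<Omega>) \<le> hausdorff_outer (\<Union>a\<in>A. frontier \<Omega> \<inter> cball a (\<rho> / 3))"
    using A(2) ball_subset_cball[of _ "\<rho> / 3"] by (intro hausdorff_outer_mono) blast
  also have "\<dots> \<le> (\<Sum>a\<in>A. hausdorff_outer (frontier \<Omega> \<inter> cball a (\<rho> / 3)))"
    by (rule hausdorff_outer_UN_finite_le[OF A(1)])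
  also have "\<dots> \<le> (\<Sum>a\<in>A. ennreal (K * (\<rho> / 3)))"
    by (intro sum_mono K)
  also have "\<dots> < \<infinity>"
    by (simp add: ennreal_mult_less_top of_nat_less_top)
  finally show ?thesis .
qed

text \<open>Up to scale \<open>\<rho> / 2\<close> the local estimate applies. Beyond it, \<open>(2 n \<epsilon> / \<rho>)\<^sup>2 \<ge> 1\<close>, so the total length is at most
  \<open>H (2 n \<epsilon> / \<rho>)\<^sup>2\<close>, and \<open>H \<epsilon> \<le> 1\<close> absorbs \<open>H\<close>. The resulting constant is therefore the same for all domains with the
  same \<open>\<rho>\<close> and \<open>\<theta>\<close>.\<close>

lemma frontier_hausdorff_growth:
  assumes op: "open \<Omega>" and bdd: "bounded \<Omega>" and reg: "lipschitz_regularity \<Omega> \<rho> \<theta>"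
    and \<epsilon>: "0 < \<epsilon>" "hausdorff_outer (frontier \<Omega>) \<le> ennreal H" "H * \<epsilon> \<le> 1" "0 \<le> H"
    and K: "0 \<le> K" "\<And>s. 0 \<le> s \<Longrightarrow> 2 * s < \<rho> \<Longrightarrow> hausdorff_outer (frontier \<Omega> \<inter> cball p s) \<le> ennreal (K * s)"
    and n: "1 \<le> (n::nat)"
  shows "emeasure hausdorff_measure (frontier \<Omega> \<inter> cball p (n * \<epsilon>)) \<le> ennreal ((K + 4 / \<rho>\<^sup>2) * \<epsilon> * (real n)\<^sup>2)"
proof -
  have \<rho>: "0 < \<rho>" using reg by (simp add: lipschitz_regularity_def)
  have "frontier \<Omega> \<inter> cball p (n * \<epsilon>) \<in> sets borel" by (intro sets.Int borel_closed) auto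
  then have "emeasure hausdorff_measure (frontier \<Omega> \<inter> cball p (n * \<epsilon>)) = hausdorff_outer (frontier \<Omega> \<inter> cball p (n * \<epsilon>))"
    by (rule emeasure_hausdorff_measure)
  also have "\<dots> \<le> ennreal ((K + 4 / \<rho>\<^sup>2) * \<epsilon> * (real n)\<^sup>2)"
  proof (cases "2 * (n * \<epsilon>) < \<rho>")
    case True
    then have "hausdorff_outer (frontier \<Omega> \<inter> cball p (n * \<epsilon>)) \<le> ennreal (K * (n * \<epsilon>))"
      using \<epsilon> by (intro K(2)) auto
    also have "K * (n * \<epsilon>) \<le> K * \<epsilon> * (real n)\<^sup>2"
      using K \<epsilon> n by (simp add: power2_eq_square mult_le_cancel_left1 mult_left_mono mult_ac)
    also have "\<dots> \<le> (K + 4 / \<rho>\<^sup>2) * \<epsilon> * (real n)\<^sup>2"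
      using \<epsilon> by (intro mult_right_mono) auto
    finally show ?thesis by (meson ennreal_leI order_trans order_refl)
  next
    case False
    have "hausdorff_outer (frontier \<Omega> \<inter> cball p (n * \<epsilon>)) \<le> hausdorff_outer (frontier \<Omega>)"
      by (rule hausdorff_outer_mono) auto
    also have "\<dots> \<le> ennreal H" by (rule \<epsilon>)
    finally have HB: "hausdorff_outer (frontier \<Omega> \<inter> cball p (n * \<epsilon>)) \<le> ennreal H" .
    have "H * \<rho>\<^sup>2 \<le> H * (2 * (n * \<epsilon>))\<^sup>2"
      using False \<rho> \<epsilon> by (intro mult_left_mono power_mono) auto
    also have "\<dots> = (H * \<epsilon>) * (4 * \<epsilon> * (real n)\<^sup>2)" by (simp add: power2_eq_square)
    also have "\<dots> \<le> 1 * (4 * \<epsilon> * (real n)\<^sup>2)" using \<epsilon> by (intro mult_right_mono) auto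
    finally have "H \<le> 4 / \<rho>\<^sup>2 * \<epsilon> * (real n)\<^sup>2" using \<rho> by (simp add: field_simps)
    also have "\<dots> \<le> (K + 4 / \<rho>\<^sup>2) * \<epsilon> * (real n)\<^sup>2"
      using \<epsilon> K by (intro mult_right_mono) auto
    finally show ?thesis using HB by (meson ennreal_leI order_trans)
  qed
  finally show ?thesis .
qed


section \<open>Uniform cones at the boundary of a Lipschitz domain\<close>

text \<open>A cone around the vertical direction \<open>n\<close> whose sides have slope \<open>M \<ge> L\<close> stays on one side of an \<open>L\<close>-Lipschitz
  graph through its vertex. The formula for \<open>cos (\<theta> / 2)\<close> is the cosine of the angle between \<open>n\<close> and a line of
  slope \<open>M\<close>.\<close>

lemma graph_cones:
  fixes e n y :: "real^2" and \<phi> :: "real \<Rightarrow> real"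
  assumes "open \<Omega>" "open U" and e: "norm e = 1" and n: "norm n = 1" and en: "e \<bullet> n = 0"
    and lip: "L-lipschitz_on UNIV \<phi>" and \<Omega>: "\<Omega> \<inter> U = {y\<in>U. \<phi> (y \<bullet> e) < y \<bullet> n}"
    and y: "y \<in> frontier \<Omega>" and r: "cball y r \<subseteq> U" "0 < r"
    and M: "L \<le> M" "0 < M" and c: "cos (\<theta> / 2) = M / sqrt (1 + M\<^sup>2)"
  shows "cone_at y n r \<theta> \<subseteq> closure \<Omega>" "cone_at y (- n) r \<theta> \<subseteq> - \<Omega>"
proof -
  have ee: "e \<bullet> e = 1" and nn: "n \<bullet> n = 1" using e n by (simp_all add: dot_square_norm)
  have yU: "y \<in> U" using r by auto
  have "y \<notin> \<Omega>" "y \<in> closure \<Omega>"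
    using y \<open>open \<Omega>\<close> by (auto simp: frontier_def interior_open)
  have \<phi>y: "\<phi> (y \<bullet> e) = y \<bullet> n"
  proof (rule antisym)
    show "y \<bullet> n \<le> \<phi> (y \<bullet> e)" using \<Omega> yU \<open>y \<notin> \<Omega>\<close> by fastforce
    show "\<phi> (y \<bullet> e) \<le> y \<bullet> n"
    proof (rule ccontr)
      assume "\<not> \<phi> (y \<bullet> e) \<le> y \<bullet> n"
      let ?W = "U \<inter> {z. z \<bullet> n < \<phi> (z \<bullet> e)}"
      have "continuous_on UNIV (\<lambda>z. \<phi> (z \<bullet> e))"
        by (rule continuous_on_compose2[OF lipschitz_on_continuous_on[OF lip]]) (auto intro: continuous_intros)
      then have "open ?W"
        by (intro open_Int \<open>open U\<close> open_Collect_less continuous_intros)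
      moreover have "y \<in> ?W" using yU \<open>\<not> \<phi> (y \<bullet> e) \<le> y \<bullet> n\<close> by simp
      ultimately obtain z where "z \<in> \<Omega>" "z \<in> ?W"
        using \<open>y \<in> closure \<Omega>\<close> by (auto simp: closure_iff_nhds_not_empty)
      then have "z \<in> \<Omega> \<inter> U" by blast
      then show False using \<open>z \<in> ?W\<close> unfolding \<Omega> by simp
    qed
  qed
  have slope: "\<bar>\<phi> (z \<bullet> e) - \<phi> (y \<bullet> e)\<bar> \<le> \<bar>(z - y) \<bullet> n\<bar>"
    if z: "norm (z - y) * cos (\<theta> / 2) \<le> \<bar>(z - y) \<bullet> n\<bar>" for z
  proof -
    define w where "w = z - y"
    have "0 \<le> (norm (w - (w \<bullet> e) *\<^sub>R e - (w \<bullet> n) *\<^sub>R n))\<^sup>2" by simp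
    also have "\<dots> = (norm w)\<^sup>2 - (w \<bullet> e)\<^sup>2 - (w \<bullet> n)\<^sup>2"
      unfolding power2_norm_eq_inner
      using ee nn en by (simp add: inner_diff_left inner_diff_right inner_commute power2_eq_square)
    finally have bessel: "(w \<bullet> e)\<^sup>2 + (w \<bullet> n)\<^sup>2 \<le> (norm w)\<^sup>2" by simp
    have "0 < 1 + M\<^sup>2" by (simp add: add_pos_nonneg)
    have "(norm w * cos (\<theta> / 2))\<^sup>2 \<le> (w \<bullet> n)\<^sup>2"
      using z c M by (subst (2) power2_abs[symmetric], intro power_mono) (auto simp: w_def)
    moreover have "(norm w * cos (\<theta> / 2))\<^sup>2 = (norm w)\<^sup>2 * M\<^sup>2 / (1 + M\<^sup>2)"
      using \<open>0 < 1 + M\<^sup>2\<close> by (simp add: c power_mult_distrib power_divide)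
    ultimately have "(norm w)\<^sup>2 * M\<^sup>2 \<le> (w \<bullet> n)\<^sup>2 * (1 + M\<^sup>2)"
      using \<open>0 < 1 + M\<^sup>2\<close> by (simp add: pos_divide_le_eq)
    moreover have "((w \<bullet> e)\<^sup>2 + (w \<bullet> n)\<^sup>2) * M\<^sup>2 \<le> (norm w)\<^sup>2 * M\<^sup>2"
      using bessel by (rule mult_right_mono) simp
    ultimately have "(M * (w \<bullet> e))\<^sup>2 \<le> (w \<bullet> n)\<^sup>2"
      by (simp add: algebra_simps power_mult_distrib)
    then have "\<bar>M * (w \<bullet> e)\<bar> \<le> \<bar>w \<bullet> n\<bar>" by (simp add: abs_le_square_iff)
    moreover have "\<bar>\<phi> (z \<bullet> e) - \<phi> (y \<bullet> e)\<bar> \<le> L * \<bar>w \<bullet> e\<bar>"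
      using lipschitz_onD[OF lip, of "z \<bullet> e" "y \<bullet> e"] by (simp add: dist_real_def w_def inner_diff_left)
    moreover have "L * \<bar>w \<bullet> e\<bar> \<le> M * \<bar>w \<bullet> e\<bar>" using M by (intro mult_right_mono) auto
    ultimately show ?thesis using M by (simp add: w_def abs_mult)
  qed
  have cpos: "0 \<le> cos (\<theta> / 2)" using c M by simp
  have zU: "z \<in> U" if "norm (z - y) \<le> r" for z
    using that r by (auto simp: dist_norm norm_minus_commute)
  show "cone_at y n r \<theta> \<subseteq> closure \<Omega>"
  proof
    fix z assume z: "z \<in> cone_at y n r \<theta>"
    then have "0 \<le> (z - y) \<bullet> n"
      using cpos by (auto simp: cone_at_def intro: order_trans[rotated])
    moreover have "z \<in> U" using z zU by (auto simp: cone_at_def)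
    ultimately have le: "\<phi> (z \<bullet> e) \<le> z \<bullet> n"
      using slope[of z] z \<phi>y by (auto simp: cone_at_def inner_diff_left)
    obtain d where d: "0 < d" "ball z d \<subseteq> U" using \<open>open U\<close> \<open>z \<in> U\<close> by (auto simp: open_contains_ball)
    show "z \<in> closure \<Omega>"
      unfolding closure_approachable
    proof (intro allI impI)
      fix \<delta> :: real assume "0 < \<delta>"
      define t where "t = min d \<delta> / 2"
      have t: "0 < t" "t < d" "t < \<delta>" using d \<open>0 < \<delta>\<close> by (auto simp: t_def min_def)
      let ?x = "z + t *\<^sub>R n"
      have "?x \<in> U" using d t n by (auto simp: subset_iff dist_norm)
      moreover have "\<phi> (?x \<bullet> e) < ?x \<bullet> n"
        using le t nn en by (simp add: inner_add_left inner_add_right inner_commute)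
      ultimately have "?x \<in> \<Omega>" using \<Omega> by blast
      moreover have "dist ?x z < \<delta>" using t n by (simp add: dist_norm)
      ultimately show "\<exists>y\<in>\<Omega>. dist y z < \<delta>" by blast
    qed
  qed
  show "cone_at y (- n) r \<theta> \<subseteq> - \<Omega>"
  proof
    fix z assume z: "z \<in> cone_at y (- n) r \<theta>"
    then have "0 \<le> (z - y) \<bullet> (- n)"
      using cpos unfolding cone_at_def by (smt (verit) mem_Collect_eq mult_nonneg_nonneg norm_ge_zero)
    then have n0: "(z - y) \<bullet> n \<le> 0" by simp
    have "z \<in> U" using z zU by (auto simp: cone_at_def)
    have "z \<bullet> n \<le> \<phi> (z \<bullet> e)"
      using slope[of z] z \<phi>y n0 by (auto simp: cone_at_def inner_diff_left)
    then have "z \<notin> \<Omega> \<inter> U" unfolding \<Omega> by simp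
    then show "z \<in> - \<Omega>" using \<open>z \<in> U\<close> by blast
  qed
qed

text \<open>Compactness of the boundary: finitely many graph charts suffice, and cones shrink when the radius decreases and the
  slope \<open>M\<close> increases, so the smallest radius and the largest slope serve all charts.\<close>

lemma lipschitz_regularity_exists:
  assumes "open \<Omega>" "bounded \<Omega>" "lipschitz_boundary \<Omega>"
  shows "\<exists>\<rho> \<theta>. lipschitz_regularity \<Omega> \<rho> \<theta>"
proof -
  have "\<exists>r n L. 0 < r \<and> norm n = 1 \<and> (\<forall>y \<rho> M \<theta>. y \<in> frontier \<Omega> \<inter> ball x r \<and> 0 < \<rho> \<and> \<rho> \<le> r \<and>
      L \<le> M \<and> 0 < M \<and> cos (\<theta> / 2) = M / sqrt (1 + M\<^sup>2) \<longrightarrow>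
      cone_at y n \<rho> \<theta> \<subseteq> closure \<Omega> \<and> cone_at y (- n) \<rho> \<theta> \<subseteq> - \<Omega>)"
    if x: "x \<in> frontier \<Omega>" for x
  proof -
    obtain U e n \<phi> L where U: "open U" "x \<in> U" "norm e = 1" "norm n = 1" "e \<bullet> n = 0"
      "L-lipschitz_on UNIV (\<phi> :: real \<Rightarrow> real)" "\<Omega> \<inter> U = {y\<in>U. \<phi> (y \<bullet> e) < y \<bullet> n}"
      using assms(3) x unfolding lipschitz_boundary_def by meson
    obtain d where d: "0 < d" "ball x d \<subseteq> U" using U by (auto simp: open_contains_ball)
    have sub: "cball y \<rho> \<subseteq> U" if "y \<in> ball x (d / 2)" "\<rho> \<le> d / 2" for y \<rho>
    proof
      fix z assume "z \<in> cball y \<rho>"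
      then have "z \<in> ball x d" using that dist_triangle[of x z y] by simp
      then show "z \<in> U" using d by blast
    qed
    have cones: "cone_at y n \<rho> \<theta> \<subseteq> closure \<Omega> \<and> cone_at y (- n) \<rho> \<theta> \<subseteq> - \<Omega>"
      if h: "y \<in> frontier \<Omega> \<inter> ball x (d / 2) \<and> 0 < \<rho> \<and> \<rho> \<le> d / 2 \<and>
        L \<le> M \<and> 0 < M \<and> cos (\<theta> / 2) = M / sqrt (1 + M\<^sup>2)" for y \<rho> M \<theta>
    proof -
      have "cball y \<rho> \<subseteq> U" using h by (intro sub) auto
      from graph_cones[OF \<open>open \<Omega>\<close> U(1,3-7) _ this] h show ?thesis by blast
    qed
    show ?thesis
    proof (rule exI[of _ "d / 2"], rule exI[of _ n], rule exI[of _ L], intro conjI[OF _ conjI] allI impI)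
      show "0 < d / 2" "norm n = 1" using d U by auto
    qed (rule cones)
  qed
  then obtain r n L where rnL: "\<And>x. x \<in> frontier \<Omega> \<Longrightarrow> 0 < r x \<and> norm (n x) = 1 \<and>
      (\<forall>y \<rho> M \<theta>. y \<in> frontier \<Omega> \<inter> ball x (r x) \<and> 0 < \<rho> \<and> \<rho> \<le> r x \<and>
      L x \<le> M \<and> 0 < M \<and> cos (\<theta> / 2) = M / sqrt (1 + M\<^sup>2) \<longrightarrow>
      cone_at y (n x) \<rho> \<theta> \<subseteq> closure \<Omega> \<and> cone_at y (- n x) \<rho> \<theta> \<subseteq> - \<Omega>)"
    by metis
  have "compact (frontier \<Omega>)" using assms by (intro compact_frontier_bounded)
  then obtain D where D: "D \<subseteq> frontier \<Omega>" "finite D" "frontier \<Omega> \<subseteq> (\<Union>x\<in>D. ball x (r x))"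
    by (rule compactE_image[where C = "frontier \<Omega>" and f = "\<lambda>x. ball x (r x)"]) (use rnL in auto)
  define \<rho> where "\<rho> = Min (insert 1 (r ` D))"
  define M where "M = Max (insert 1 (L ` D))"
  define c where "c = M / sqrt (1 + M\<^sup>2)"
  define \<theta> where "\<theta> = 2 * arccos c"
  have \<rho>: "0 < \<rho>" "\<And>x. x \<in> D \<Longrightarrow> \<rho> \<le> r x"
    using D rnL by (auto simp: \<rho>_def)
  have M1: "1 \<le> M" "\<And>x. x \<in> D \<Longrightarrow> L x \<le> M"
    using D by (auto simp: M_def)
  have "M = sqrt (M\<^sup>2)" using M1 by simp
  then have "M < sqrt (1 + M\<^sup>2)" by (metis less_add_one add.commute real_sqrt_less_iff)
  then have c: "0 < c" "c < 1" using M1 by (auto simp: c_def add_pos_nonneg)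
  have "arccos c < arccos 0" "arccos 1 < arccos c" using c by (intro arccos_less_arccos; simp)+
  then have \<theta>: "0 < \<theta>" "\<theta> < pi" "cos (\<theta> / 2) = c"
    using c by (auto simp: \<theta>_def)
  have "lipschitz_regularity \<Omega> \<rho> \<theta>"
    unfolding lipschitz_regularity_def
  proof (intro conjI \<rho> \<theta> ballI)
    fix y assume y: "y \<in> frontier \<Omega>"
    then obtain x where x: "x \<in> D" "y \<in> ball x (r x)" using D by blast
    then have xf: "x \<in> frontier \<Omega>" using D(1) by blast
    note rnL[OF xf, THEN conjunct2, THEN conjunct2, rule_format, of y \<rho> M \<theta>]
    then show "\<exists>\<nu>. norm \<nu> = 1 \<and> cone_at y \<nu> \<rho> \<theta> \<subseteq> closure \<Omega> \<and> cone_at y (- \<nu>) \<rho> \<theta> \<subseteq> - \<Omega>"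
      using rnL[OF xf] x y \<rho>(1) \<rho>(2)[OF x(1)] M1(1) M1(2)[OF x(1)] \<theta>(3)
      by (intro exI[of _ "n x"]) (simp add: c_def)
  qed
  then show ?thesis by blast
qed

section \<open>Traces of Lipschitz functions on the boundary\<close>

text \<open>Along the set the distance from \<open>x\<close> is asymptotically the tangential displacement, so difference
  quotients of \<open>g\<close> approach the norm of the tangential derivative. Applied to the difference of \<open>g\<close> with itself, the same
  estimate shows that the derivative is unique. The hypothesis bounds difference quotients within
  the set because boundary points on the circle where the profile starts have no full neighbourhood on which \<open>g\<close> is
  known to be differentiable.\<close>

lemma norm_tangential_deriv_le:
  assumes M: "0 \<le> M"
    and lip: "\<And>M'. M < M' \<Longrightarrow> \<forall>\<^sub>F y in at x within S. norm (g y - g x) \<le> M' * norm (y - x)"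
  shows "norm (tangential_deriv S g x) \<le> M"
proof (cases "(\<exists>\<tau>. is_unit_tangent S x \<tau>) \<and>
    (\<exists>d. (g has_derivative (\<lambda>v. (v \<bullet> unit_tangent S x) *\<^sub>R d)) (at x within S))")
  case True
  define \<tau> where "\<tau> = unit_tangent S x"
  have \<tau>: "is_unit_tangent S x \<tau>"
    using True someI_ex[of "is_unit_tangent S x"] by (simp add: \<tau>_def unit_tangent_def)
  then have nt: "at x within S \<noteq> bot" and ratio: "((\<lambda>y. \<bar>(y - x) \<bullet> \<tau>\<bar> / norm (y - x)) \<longlongrightarrow> 1) (at x within S)"
    by (auto simp: is_unit_tangent_def trivial_limit_within)
  let ?D = "\<lambda>d. (g has_derivative (\<lambda>v. (v \<bullet> \<tau>) *\<^sub>R d)) (at x within S)"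
  have bound: "norm (d - d') \<le> K"
    if d: "?D d" and d': "(f has_derivative (\<lambda>v. (v \<bullet> \<tau>) *\<^sub>R d')) (at x within S)"
      and K: "\<forall>\<^sub>F y in at x within S. norm ((g y - f y) - (g x - f x)) \<le> K * norm (y - x)" for d d' f K
  proof -
    let ?G = "\<lambda>y. g y - f y"
    have "(?G has_derivative (\<lambda>v. (v \<bullet> \<tau>) *\<^sub>R (d - d'))) (at x within S)"
      using has_derivative_diff[OF d d'] by (simp add: scaleR_diff_right)
    then have "((\<lambda>y. norm (?G y - ?G x - ((y - x) \<bullet> \<tau>) *\<^sub>R (d - d')) / norm (y - x)) \<longlongrightarrow> 0) (at x within S)"
      by (simp add: has_derivative_iff_norm)
    then have "((\<lambda>y. K + norm (?G y - ?G x - ((y - x) \<bullet> \<tau>) *\<^sub>R (d - d')) / norm (y - x)) \<longlongrightarrow> K + 0) (at x within S)"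
      by (intro tendsto_intros)
    moreover have "((\<lambda>y. \<bar>(y - x) \<bullet> \<tau>\<bar> / norm (y - x) * norm (d - d')) \<longlongrightarrow> 1 * norm (d - d')) (at x within S)"
      by (intro tendsto_intros ratio)
    moreover have "\<forall>\<^sub>F y in at x within S. \<bar>(y - x) \<bullet> \<tau>\<bar> / norm (y - x) * norm (d - d')
        \<le> K + norm (?G y - ?G x - ((y - x) \<bullet> \<tau>) *\<^sub>R (d - d')) / norm (y - x)"
      using K eventually_neq_at_within[of x x S]
    proof (eventually_elim, goal_cases)
      case (1 y)
      have "\<bar>(y - x) \<bullet> \<tau>\<bar> * norm (d - d') \<le> norm (?G y - ?G x) + norm (?G y - ?G x - ((y - x) \<bullet> \<tau>) *\<^sub>R (d - d'))"
        using norm_triangle_sub[of "((y - x) \<bullet> \<tau>) *\<^sub>R (d - d')" "?G y - ?G x"]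
        by (simp add: norm_minus_commute)
      then show ?case using 1
        by (auto simp: field_simps)
    qed
    ultimately have "1 * norm (d - d') \<le> K + 0"
      using tendsto_le[OF nt] by blast
    then show ?thesis by simp
  qed
  have unique: "d = d'" if "?D d" "?D d'" for d d'
    using bound[OF that, of 0] by simp
  obtain d where d: "?D d" using True by (auto simp: \<tau>_def)
  then have "tangential_deriv S g x = d"
    unfolding tangential_deriv_def \<tau>_def[symmetric] using True unique by (auto simp: \<tau>_def intro!: the_equality)
  moreover have "norm d \<le> M'" if "M < M'" for M'
    using bound[OF d, of "\<lambda>_. 0" 0 M'] lip[OF that] by simp
  then have "norm d \<le> M" by (rule dense_ge)
  ultimately show ?thesis by simp
qed (use M in \<open>auto simp: tangential_deriv_def\<close>)

lemma lipschitz_imp_abs_continuous_along: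
  fixes g :: "real^2 \<Rightarrow> real^2"
  assumes g: "K-lipschitz_on S g"
  shows "abs_continuous_along S g"
  unfolding abs_continuous_along_def
proof (intro conjI allI impI)
  show "continuous_on S g" using g by (rule lipschitz_on_continuous_on)
  fix \<gamma> :: "real \<Rightarrow> real^2" and L
  assume \<gamma>: "arc \<gamma> \<and> L-lipschitz_on {0..1} \<gamma> \<and> path_image \<gamma> \<subseteq> S"
  have lip: "(K * L)-lipschitz_on {0..1} (g \<circ> \<gamma>)"
    using \<gamma> g by (intro lipschitz_on_compose lipschitz_on_subset[OF g]) (auto simp: path_image_def)
  then have KL: "0 \<le> K * L" by (rule lipschitz_on_nonneg)
  show "abs_continuous_on_interval 0 1 (g \<circ> \<gamma>)"
    unfolding abs_continuous_on_interval_def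
  proof (intro allI impI)
    fix \<eta> :: real assume \<eta>: "0 < \<eta>"
    show "\<exists>\<delta>>0. \<forall>D. finite D \<and> (\<forall>(s, t)\<in>D. 0 \<le> s \<and> s \<le> t \<and> t \<le> 1) \<and>
        pairwise (\<lambda>(s, t) (s', t'). {s<..<t} \<inter> {s'<..<t'} = {}) D \<and>
        (\<Sum>(s, t)\<in>D. t - s) < \<delta> \<longrightarrow> (\<Sum>(s, t)\<in>D. dist ((g \<circ> \<gamma>) s) ((g \<circ> \<gamma>) t)) < \<eta>"
    proof (intro exI[of _ "\<eta> / (K * L + 1)"] conjI allI impI)
      show "0 < \<eta> / (K * L + 1)" using \<eta> KL by simp
      fix D :: "(real \<times> real) set"
      assume D: "finite D \<and> (\<forall>(s, t)\<in>D. 0 \<le> s \<and> s \<le> t \<and> t \<le> 1) \<and>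
        pairwise (\<lambda>(s, t) (s', t'). {s<..<t} \<inter> {s'<..<t'} = {}) D \<and>
        (\<Sum>(s, t)\<in>D. t - s) < \<eta> / (K * L + 1)"
      have "(\<Sum>(s, t)\<in>D. dist ((g \<circ> \<gamma>) s) ((g \<circ> \<gamma>) t)) \<le> (\<Sum>(s, t)\<in>D. K * L * (t - s))"
      proof (rule sum_mono)
        fix q assume "q \<in> D"
        then obtain s t where q: "q = (s, t)" "0 \<le> s" "s \<le> t" "t \<le> 1" using D by (cases q) auto
        then show "(case q of (s, t) \<Rightarrow> dist ((g \<circ> \<gamma>) s) ((g \<circ> \<gamma>) t)) \<le> (case q of (s, t) \<Rightarrow> K * L * (t - s))"
          using lipschitz_onD[OF lip, of s t] by (simp add: dist_real_def)
      qed
      also have "\<dots> = K * L * (\<Sum>(s, t)\<in>D. t - s)"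
        by (simp add: sum_distrib_left case_prod_beta)
      also have "\<dots> \<le> K * L * (\<eta> / (K * L + 1))"
        using D KL by (intro mult_left_mono) auto
      also have "\<dots> < \<eta>" using \<eta> KL by (simp add: field_simps)
      finally show "(\<Sum>(s, t)\<in>D. dist ((g \<circ> \<gamma>) s) ((g \<circ> \<gamma>) t)) < \<eta>" .
    qed
  qed
qed

section \<open>Solutions vanishing on a small exterior circle\<close>

lemma dist_ge_on_closure:
  assumes "\<And>x. x \<in> S \<Longrightarrow> r \<le> dist x p" and "x \<in> closure S"
  shows "r \<le> dist x p"
proof -
  have "closure S \<subseteq> {x. r \<le> dist x p}"
    using assms(1) by (intro closure_minimal closed_Collect_le continuous_intros) auto
  then show ?thesis using assms(2) by blast
qed

lemma norm_sq_components:
  fixes w :: "real^2"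
  shows "w \<bullet> w = (w$1)\<^sup>2 + (w$2)\<^sup>2"
  by (simp add: inner_vec_def sum_2 power2_eq_square)

lemma ln_diff_le:
  fixes a b m :: real
  assumes "0 < m" "m \<le> a" "m \<le> b"
  shows "\<bar>ln a - ln b\<bar> \<le> \<bar>a - b\<bar> / m"
proof -
  have *: "ln a - ln b \<le> \<bar>a - b\<bar> / m" if "m \<le> a" "m \<le> b" for a b
  proof -
    have "ln a - ln b = ln (a / b)" using that assms(1) by (simp add: ln_div)
    also have "\<dots> \<le> a / b - 1" using that assms(1) by (intro ln_le_minus_one) auto
    also have "\<dots> = (a - b) / b" using that assms(1) by (simp add: field_simps)
    also have "\<dots> \<le> \<bar>a - b\<bar> / b" using that assms(1) by (intro divide_right_mono) auto
    also have "\<dots> \<le> \<bar>a - b\<bar> / m" using that assms(1) by (intro divide_left_mono) auto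
    finally show ?thesis .
  qed
  show ?thesis using *[of a b] *[of b a] assms by (simp add: abs_le_iff abs_minus_commute)
qed

text \<open>The profile composed with \<open>h x = ln (\<bar>x - p\<bar> / \<epsilon>)\<close>. The interval length \<open>T\<close> exceeds \<open>h\<close> on the closure of the domain, so
  the endpoint \<open>T\<close> is never reached; the endpoint \<open>0\<close> may be reached on the boundary, which is why the last
  estimate is stated on the closure and proved by the mean value theorem on the profile.\<close>

lemma gl_solution_outside_disc:
  fixes \<Omega> :: "(real^2) set" and p :: "real^2"
  assumes op: "open \<Omega>" and bdd: "bounded \<Omega>" and \<epsilon>: "0 < \<epsilon>"
    and far: "\<And>x. x \<in> \<Omega> \<Longrightarrow> \<epsilon> < dist x p"
  obtains u where "gl_solution \<epsilon> \<Omega> u u"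
    and "\<And>x. dist x p = \<epsilon> \<Longrightarrow> u x = 0"
    and "\<And>x. x \<in> closure \<Omega> \<Longrightarrow> (1 - (norm (u x))\<^sup>2)\<^sup>2 \<le> 576 * (\<epsilon> / dist x p) ^ 4"
    and "\<And>x. x \<in> \<Omega> \<Longrightarrow> (\<Sum>i\<in>UNIV. (norm (partial i u x))\<^sup>2) \<le> (120 * \<epsilon>\<^sup>2 / dist x p ^ 3)\<^sup>2"
    and "\<And>x y m. \<lbrakk>x \<in> closure \<Omega>; y \<in> closure \<Omega>; \<epsilon> \<le> m; m \<le> dist x p; m \<le> dist y p\<rbrakk> \<Longrightarrow>
      norm (u x - u y) \<le> 120 * \<epsilon>\<^sup>2 / m ^ 3 * norm (x - y)"
proof -
  obtain R0 where R0: "\<And>x. x \<in> closure \<Omega> \<Longrightarrow> dist p x \<le> R0"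
    using bounded_closure[OF bdd] by (meson bounded_any_center)
  define R where "R = max \<epsilon> R0"
  have R: "\<epsilon> \<le> R" "\<And>x. x \<in> closure \<Omega> \<Longrightarrow> dist x p \<le> R"
    using R0 by (auto simp: R_def dist_commute intro: max.coboundedI2)
  (* adding 2 ensures 1 < T and makes h stay strictly below T *)
  define T where "T = ln (R / \<epsilon>) + 2"
  have "0 \<le> ln (R / \<epsilon>)" using R(1) \<epsilon> by (intro ln_ge_zero) simp
  then have T: "1 < T" by (simp add: T_def)
  obtain V V' :: "real \<Rightarrow> real" where V_cont: "continuous_on {0..T} V" and V0: "V 0 = 0"
    and V_bd: "\<And>t. t \<in> {0..T} \<Longrightarrow> 0 \<le> V t \<and> V t \<le> 1 \<and> 1 - V t \<le> 12 * exp (- 2 * t)"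
    and V1: "\<And>t. 0 < t \<Longrightarrow> t < T \<Longrightarrow> (V has_real_derivative V' t) (at t)"
    and V'_bd: "\<And>t. 0 < t \<Longrightarrow> t < T \<Longrightarrow> \<bar>V' t\<bar> \<le> 120 * exp (- 2 * t)"
    and V2: "\<And>t. 0 < t \<Longrightarrow> t < T \<Longrightarrow> (V' has_real_derivative exp (2 * t) * (V t ^ 3 - V t)) (at t)"
    using radial_profile[OF T] by blast
  define h where "h x = ln (norm (x - p)) - ln \<epsilon>" for x
  define e :: "real^2" where "e = axis 1 1"
  have e: "norm e = 1" by (simp add: e_def norm_axis_1)
  define u where "u x = V (h x) *\<^sub>R e" for x
  have near: "\<epsilon> \<le> dist x p" if "x \<in> closure \<Omega>" for x
    by (rule dist_ge_on_closure[OF less_imp_le[OF far] that])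
  have exp_h: "exp (h x) = dist x p / \<epsilon>" "exp (- 2 * h x) = (\<epsilon> / dist x p)\<^sup>2" "exp (2 * h x) = (dist x p / \<epsilon>)\<^sup>2"
    if "\<epsilon> \<le> dist x p" for x
  proof -
    have "0 < norm (x - p)" using that \<epsilon> unfolding dist_norm by linarith
    then show e1: "exp (h x) = dist x p / \<epsilon>"
      using \<epsilon> by (simp only: h_def exp_diff exp_ln dist_norm)
    show "exp (2 * h x) = (dist x p / \<epsilon>)\<^sup>2"
      by (simp only: exp_double e1)
    then show "exp (- 2 * h x) = (\<epsilon> / dist x p)\<^sup>2"
      by (simp add: exp_minus power_divide)
  qed
  have h_cl: "h x \<in> {0..T}" "h x < T" if x: "x \<in> closure \<Omega>" for x
  proof -
    have r: "\<epsilon> \<le> norm (x - p)" "norm (x - p) \<le> R" using near[OF x] R(2)[OF x] by (simp_all add: dist_norm)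
    then have "ln \<epsilon> \<le> ln (norm (x - p))" using \<epsilon> by (intro ln_mono) auto
    moreover have "0 < norm (x - p)" using r \<epsilon> by linarith
    then have "ln (norm (x - p)) \<le> ln R" using r by (intro ln_mono) auto
    moreover have "T = ln R - ln \<epsilon> + 2" using R(1) \<epsilon> by (simp add: T_def ln_div)
    ultimately show "h x \<in> {0..T}" "h x < T" by (auto simp: h_def)
  qed
  have h_in: "0 < h x" "h x < T" if x: "x \<in> \<Omega>" for x
  proof -
    have "\<epsilon> < norm (x - p)" using far[OF x] by (simp add: dist_norm)
    then have "ln \<epsilon> < ln (norm (x - p))" using \<epsilon> by (rule ln_strict_mono)
    then show "0 < h x" by (simp add: h_def)
    show "h x < T" using h_cl(2) closure_subset x by blast
  qed
  define q where "q x = (x - p) \<bullet> (x - p)" for x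
  have q_dist: "q x = (dist x p)\<^sup>2" for x by (simp add: q_def dist_norm power2_norm_eq_inner)
  have q_pos: "0 < q x" if "x \<in> \<Omega>" for x
  proof -
    have "0 < dist x p" using far[OF that] \<epsilon> by linarith
    then show ?thesis unfolding q_dist by (rule zero_less_power)
  qed
  have h_d: "(h has_derivative (\<lambda>w. ((x - p) \<bullet> w) / q x)) (at x)" if x: "x \<in> \<Omega>" for x
  proof -
    have "x - p \<noteq> 0" using q_pos[OF x] by (auto simp: q_def)
    have "((\<lambda>x. x - p) has_derivative (\<lambda>w. w)) (at x)"
      by (auto intro!: derivative_eq_intros)
    from has_derivative_compose[OF this has_derivative_norm[OF \<open>x - p \<noteq> 0\<close>]]
    have n: "((\<lambda>x. norm (x - p)) has_derivative (\<lambda>w. sgn (x - p) \<bullet> w)) (at x)"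
      by (simp add: inner_commute)
    have "((\<lambda>x. ln (norm (x - p))) has_derivative (\<lambda>w. inverse (norm (x - p)) * (sgn (x - p) \<bullet> w))) (at x)"
      using has_derivative_compose[OF n DERIV_ln[unfolded has_field_derivative_def]] \<open>x - p \<noteq> 0\<close> by simp
    then have "(h has_derivative (\<lambda>w. inverse (norm (x - p)) * (sgn (x - p) \<bullet> w) - 0)) (at x)"
      unfolding h_def[abs_def] by (intro has_derivative_diff has_derivative_const)
    moreover have "inverse (norm (x - p)) * (sgn (x - p) \<bullet> w) - 0 = ((x - p) \<bullet> w) / q x" for w
      by (simp add: q_def sgn_div_norm divide_inverse dot_square_norm power2_eq_square)
    ultimately show ?thesis by simp
  qed
  have comp_d: "((\<lambda>x. f (h x)) has_derivative (\<lambda>w. f' * (((x - p) \<bullet> w) / q x))) (at x)"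
    if x: "x \<in> \<Omega>" and f: "(f has_real_derivative f') (at (h x))" for f f' x
    using has_derivative_compose[OF h_d[OF x] f[unfolded has_field_derivative_def]] .
  have u_d: "(u has_derivative (\<lambda>w. (V' (h x) * (((x - p) \<bullet> w) / q x)) *\<^sub>R e)) (at x)" if x: "x \<in> \<Omega>" for x
    unfolding u_def[abs_def]
    by (rule has_derivative_scaleR_left[OF comp_d[OF x V1[OF h_in[OF x]]]])
  define W where "W i x = V' (h x) * ((x - p) $ i / q x)" for i :: 2 and x
  have p1: "partial i u x = W i x *\<^sub>R e" if x: "x \<in> \<Omega>" for i x
    unfolding partial_def frechet_derivative_at[OF u_d[OF x], symmetric]
    by (simp add: W_def inner_axis)
  define V'' where "V'' t = exp (2 * t) * (V t ^ 3 - V t)" for t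
  have q_d: "(q has_derivative (\<lambda>w. 2 * ((x - p) \<bullet> w))) (at x)" for x
    unfolding q_def[abs_def] by (auto intro!: derivative_eq_intros simp: inner_commute)
  have c_d: "((\<lambda>x. (x - p) $ i) has_derivative (\<lambda>w. w $ i)) (at x)" for i x
    by (rule bounded_linear.has_derivative[OF bounded_linear_vec_nth]) (auto intro!: derivative_eq_intros)
  have W_d: "(W i has_derivative (\<lambda>w. V' (h x) * ((w $ i * q x - (x - p) $ i * (2 * ((x - p) \<bullet> w))) / (q x * q x))
      + V'' (h x) * (((x - p) \<bullet> w) / q x) * ((x - p) $ i / q x))) (at x)" if x: "x \<in> \<Omega>" for i x
  proof -
    have "q x \<noteq> 0" using q_pos[OF x] by simp
    show ?thesis
      unfolding W_def[abs_def] V''_def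
      by (rule has_derivative_mult[OF comp_d[OF x V2[OF h_in[OF x]]] has_derivative_divide'[OF c_d q_d \<open>q x \<noteq> 0\<close>]])
  qed
  (* the second partial derivatives: the derivative of W i in the direction of the j-th axis *)
  define H where "H i j x = V' (h x) * ((axis j 1 $ i * q x - (x - p) $ i * (2 * (x - p) $ j)) / (q x * q x))
      + V'' (h x) * ((x - p) $ j / q x) * ((x - p) $ i / q x)" for i j :: 2 and x
  have pu_d: "(partial i u has_derivative (\<lambda>w. (V' (h x) * ((w $ i * q x - (x - p) $ i * (2 * ((x - p) \<bullet> w))) / (q x * q x))
      + V'' (h x) * (((x - p) \<bullet> w) / q x) * ((x - p) $ i / q x)) *\<^sub>R e)) (at x)" if x: "x \<in> \<Omega>" for i x
    by (rule has_derivative_transform_within_open[OF has_derivative_scaleR_left[OF W_d[OF x]] op x])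
      (simp add: p1)
  have p2: "partial j (partial i u) x = H i j x *\<^sub>R e" if x: "x \<in> \<Omega>" for i j x
    unfolding partial_def[of j] frechet_derivative_at[OF pu_d[OF x], symmetric]
    by (simp add: H_def inner_axis)
  have h_cont: "continuous_on \<Omega> h"
    using h_d by (intro continuous_at_imp_continuous_on ballI) (rule has_derivative_continuous)
  have V_h: "continuous_on \<Omega> (\<lambda>x. V (h x))"
    using comp_d[OF _ V1[OF h_in]] by (intro continuous_at_imp_continuous_on ballI) (rule has_derivative_continuous)
  have V'_h: "continuous_on \<Omega> (\<lambda>x. V' (h x))"
    using comp_d[OF _ V2[OF h_in]] by (intro continuous_at_imp_continuous_on ballI) (rule has_derivative_continuous)
  have C2: "C2_on \<Omega> u"
    unfolding C2_on_def
  proof (intro conjI ballI allI)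
    show "u differentiable at x" if "x \<in> \<Omega>" for x using u_d[OF that] by (rule differentiableI)
    show "partial i u differentiable at x" if "x \<in> \<Omega>" for x i using pu_d[OF that] by (rule differentiableI)
    fix i j
    have "continuous_on \<Omega> (\<lambda>x. H i j x *\<^sub>R e)"
      unfolding H_def V''_def q_def
      by (intro continuous_intros V_h V'_h h_cont) (use q_pos in \<open>auto simp: q_def\<close>)
    then show "continuous_on \<Omega> (partial j (partial i u))"
      by (rule continuous_on_eq) (simp add: p2)
  qed
  have lap: "laplacian u x = ((V (h x) ^ 3 - V (h x)) / \<epsilon>\<^sup>2) *\<^sub>R e" if x: "x \<in> \<Omega>" for x
  proof -
    have "laplacian u x = (H 1 1 x + H 2 2 x) *\<^sub>R e"
      by (simp add: laplacian_def sum_2 p2[OF x] scaleR_add_left)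
    (* the terms with V' cancel since the logarithm of the distance is harmonic in the plane *)
    also have "H 1 1 x + H 2 2 x = V'' (h x) / q x"
    proof -
      have q2: "q x = ((x - p) $ 1)\<^sup>2 + ((x - p) $ 2)\<^sup>2" unfolding q_def by (rule norm_sq_components)
      have "H 1 1 x + H 2 2 x = V' (h x) * ((2 * q x - 2 * (((x - p) $ 1)\<^sup>2 + ((x - p) $ 2)\<^sup>2)) / (q x * q x))
          + V'' (h x) * ((((x - p) $ 1)\<^sup>2 + ((x - p) $ 2)\<^sup>2) / (q x * q x))"
        by (simp add: H_def axis_def power2_eq_square add_divide_distrib diff_divide_distrib algebra_simps)
      then show ?thesis using q_pos[OF x] unfolding q2[symmetric] by simp
    qed
    also have "V'' (h x) / q x = (V (h x) ^ 3 - V (h x)) / \<epsilon>\<^sup>2"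
      unfolding V''_def using exp_h(3)[OF less_imp_le[OF far[OF x]]] q_pos[OF x]
      by (simp add: q_dist power_divide)
    finally show ?thesis .
  qed
  have lip: "norm (u x - u y) \<le> 120 * \<epsilon>\<^sup>2 / m ^ 3 * norm (x - y)"
    if x: "x \<in> closure \<Omega>" and y: "y \<in> closure \<Omega>" and m: "\<epsilon> \<le> m" "m \<le> dist x p" "m \<le> dist y p" for x y m
  proof -
    have m0: "0 < m" using m \<epsilon> by simp
    have mh: "ln m - ln \<epsilon> \<le> h x" "ln m - ln \<epsilon> \<le> h y"
      using ln_mono[of m "norm (x - p)"] ln_mono[of m "norm (y - p)"] m m0 by (auto simp: h_def dist_norm)
    have em: "exp (- 2 * (ln m - ln \<epsilon>)) = (\<epsilon> / m)\<^sup>2"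
    proof -
      have "- 2 * (ln m - ln \<epsilon>) = 2 * ln (\<epsilon> / m)" using m0 \<epsilon> by (simp add: ln_div)
      then show ?thesis using m0 \<epsilon> by (simp only: exp_double) simp
    qed
    have mvt: "\<bar>V t - V s\<bar> \<le> 120 * (\<epsilon> / m)\<^sup>2 * (t - s)"
      if st: "ln m - ln \<epsilon> \<le> s" "0 \<le> s" "s < t" "t \<le> T" for s t
    proof -
      have "continuous_on {s..t} V" using st by (intro continuous_on_subset[OF V_cont]) auto
      moreover have "V differentiable (at z)" if "s < z" "z < t" for z
        using V1[of z] that st by (meson le_less_trans less_le_trans real_differentiable_def)
      ultimately obtain l z where z: "s < z" "z < t" "(V has_real_derivative l) (at z)" "V t - V s = (t - s) * l"
        using MVT[OF \<open>s < t\<close>] by blast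
      have z': "0 < z" "z < T" using z st by auto
      have "l = V' z" using DERIV_unique[OF z(3) V1[OF z']] .
      then have "\<bar>l\<bar> \<le> 120 * exp (- 2 * z)" using V'_bd[OF z'] by simp
      also have "\<dots> \<le> 120 * exp (- 2 * (ln m - ln \<epsilon>))" using z st by simp
      finally have "\<bar>l\<bar> \<le> 120 * (\<epsilon> / m)\<^sup>2" by (simp only: em)
      then have "(t - s) * \<bar>l\<bar> \<le> (t - s) * (120 * (\<epsilon> / m)\<^sup>2)" using st by (intro mult_left_mono) auto
      then show ?thesis using st z(4) by (simp add: abs_mult mult_ac)
    qed
    have "\<bar>V (h x) - V (h y)\<bar> \<le> 120 * (\<epsilon> / m)\<^sup>2 * \<bar>h x - h y\<bar>"
      using mvt[of "h x" "h y"] mvt[of "h y" "h x"] mh h_cl[OF x] h_cl[OF y]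
      by (cases "h x" "h y" rule: linorder_cases) (auto simp: abs_minus_commute)
    also have "\<bar>h x - h y\<bar> = \<bar>ln (dist x p) - ln (dist y p)\<bar>" by (simp add: h_def dist_norm)
    also have "\<dots> \<le> \<bar>dist x p - dist y p\<bar> / m" using m0 m by (intro ln_diff_le) auto
    also have "\<bar>dist x p - dist y p\<bar> \<le> norm (x - y)"
      using norm_triangle_ineq3[of "x - p" "y - p"] by (simp add: dist_norm)
    finally have "\<bar>V (h x) - V (h y)\<bar> \<le> 120 * (\<epsilon> / m)\<^sup>2 * (norm (x - y) / m)"
      using m0 by (simp add: divide_right_mono mult_left_mono)
    moreover have "norm (u x - u y) = \<bar>V (h x) - V (h y)\<bar>"
      by (simp add: u_def e flip: scaleR_diff_left)
    ultimately show ?thesis by (simp add: power_divide eval_nat_numeral mult_ac)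
  qed
  have u_cont: "continuous_on (closure \<Omega>) u"
    unfolding u_def[abs_def]
  proof (intro continuous_on_scaleR continuous_on_compose2[OF V_cont] continuous_on_const)
    show "continuous_on (closure \<Omega>) h"
      unfolding h_def using near \<epsilon> by (intro continuous_intros) (force simp: dist_norm)+
  qed (use h_cl in auto)
  have norm_u: "norm (u x) = \<bar>V (h x)\<bar>" for x by (simp add: u_def e)
  show thesis
  proof (rule that)
    show "gl_solution \<epsilon> \<Omega> u u"
      unfolding gl_solution_def
    proof (intro conjI ballI C2 u_cont)
      fix x assume x: "x \<in> \<Omega>"
      show "- laplacian u x = (1 / \<epsilon>\<^sup>2 * (1 - (norm (u x))\<^sup>2)) *\<^sub>R u x"
        unfolding lap[OF x] norm_u by (simp add: u_def algebra_simps power2_eq_square power3_eq_cube diff_divide_distrib flip: scaleR_minus_left scaleR_diff_left)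
    qed simp
    show "u x = 0" if "dist x p = \<epsilon>" for x
      using that V0 by (simp add: u_def h_def dist_norm)
    show "(1 - (norm (u x))\<^sup>2)\<^sup>2 \<le> 576 * (\<epsilon> / dist x p) ^ 4" if x: "x \<in> closure \<Omega>" for x
    proof -
      have V: "0 \<le> V (h x)" "V (h x) \<le> 1" "1 - V (h x) \<le> 12 * (\<epsilon> / dist x p)\<^sup>2"
        using V_bd[OF h_cl(1)[OF x]] unfolding exp_h(2)[OF near[OF x]] by auto
      have "0 \<le> 1 - (V (h x))\<^sup>2" using V by (simp add: power_le_one)
      moreover have "1 - (V (h x))\<^sup>2 = (1 - V (h x)) * (1 + V (h x))" by (simp add: algebra_simps power2_eq_square)
      moreover have "(1 - V (h x)) * (1 + V (h x)) \<le> 12 * (\<epsilon> / dist x p)\<^sup>2 * 2"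
        using V by (intro mult_mono) auto
      ultimately have "(1 - (V (h x))\<^sup>2)\<^sup>2 \<le> (24 * (\<epsilon> / dist x p)\<^sup>2)\<^sup>2"
        by (intro power_mono) auto
      then show ?thesis by (simp add: norm_u power_mult_distrib flip: power_mult)
    qed
    show "(\<Sum>i\<in>UNIV. (norm (partial i u x))\<^sup>2) \<le> (120 * \<epsilon>\<^sup>2 / dist x p ^ 3)\<^sup>2" if x: "x \<in> \<Omega>" for x
    proof -
      have d0: "0 < dist x p" using far[OF x] \<epsilon> by linarith
      have "(\<Sum>i\<in>UNIV. (norm (partial i u x))\<^sup>2) = (V' (h x))\<^sup>2 * ((((x - p) $ 1)\<^sup>2 + ((x - p) $ 2)\<^sup>2) / (q x)\<^sup>2)"
        by (simp add: sum_2 p1[OF x] W_def e power_mult_distrib power_divide add_divide_distrib distrib_left)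
      also have "((x - p) $ 1)\<^sup>2 + ((x - p) $ 2)\<^sup>2 = q x" by (simp add: q_def norm_sq_components)
      also have "q x / (q x)\<^sup>2 = (1 / dist x p)\<^sup>2"
        using d0 by (simp add: q_dist power2_eq_square)
      also have "(V' (h x))\<^sup>2 * (1 / dist x p)\<^sup>2 = (\<bar>V' (h x)\<bar> / dist x p)\<^sup>2"
        by (simp add: power_divide)
      also have "\<dots> \<le> (120 * (\<epsilon> / dist x p)\<^sup>2 / dist x p)\<^sup>2"
        using V'_bd[OF h_in[OF x]] d0 unfolding exp_h(2)[OF less_imp_le[OF far[OF x]]]
        by (intro power_mono divide_right_mono) auto
      finally show ?thesis by (simp add: power_divide eval_nat_numeral mult_ac)
    qed
  qed (rule lip)
qed

section \<open>The two energies\<close>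

text \<open>Decompose into the rings \<open>n + 1 \<le> dist x p / \<epsilon> < n + 2\<close>. The fourth power in the density beats the quadratic growth of
  the measure and leaves the convergent sum of inverse squares. The same estimate serves area and boundary
  length, with different \<open>c\<close>.\<close>

lemma nn_integral_inverse_fourth_power_le:
  fixes M :: "'a::metric_space measure" and f :: "'a \<Rightarrow> ennreal" and \<epsilon> :: real
  assumes M: "sets M = sets borel" and A: "A \<in> sets borel" and \<epsilon>: "0 < \<epsilon>"
    and b: "0 \<le> b" and c: "0 \<le> c"
    and far: "\<And>x. x \<in> A \<Longrightarrow> \<epsilon> \<le> dist x p"
    and growth: "\<And>n::nat. 1 \<le> n \<Longrightarrow> emeasure M (A \<inter> cball p (n * \<epsilon>)) \<le> ennreal (c * (real n)\<^sup>2)"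
    and f: "\<And>x. x \<in> A \<Longrightarrow> f x \<le> ennreal (b * (\<epsilon> / dist x p) ^ 4)"
  shows "(\<integral>\<^sup>+x\<in>A. f x \<partial>M) \<le> ennreal (4 * (pi\<^sup>2 / 6) * b * c)"
proof -
  let ?S = "\<lambda>n::nat. A \<inter> cball p (real (n + 2) * \<epsilon>)"
  have S: "?S n \<in> sets M" for n
    using A by (simp add: M)
  have "f x * indicator A x \<le> (\<Sum>n. ennreal (b / (real n + 1) ^ 4) * indicator (?S n) x)" for x
  proof (cases "x \<in> A")
    case True
    define r where "r = dist x p / \<epsilon>"
    have r: "1 \<le> r" "dist x p = r * \<epsilon>" using far[OF True] \<epsilon> by (auto simp: r_def)
    define n where "n = nat \<lfloor>r\<rfloor> - 1"
    have n: "real n + 1 \<le> r" "r \<le> real n + 2"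
      using r(1) unfolding n_def by linarith+
    have "x \<in> ?S n"
      using True r(2) n(2) \<epsilon> by (simp add: dist_commute)
    have "f x \<le> ennreal (b * (\<epsilon> / dist x p) ^ 4)" by (rule f[OF True])
    also have "\<epsilon> / dist x p = 1 / r" using \<epsilon> by (simp add: r_def)
    also have "b * (1 / r) ^ 4 \<le> b * (1 / (real n + 1)) ^ 4"
      using n r(1) b by (intro mult_left_mono power_mono divide_left_mono) auto
    then have "ennreal (b * (1 / r) ^ 4) \<le> ennreal (b / (real n + 1) ^ 4)"
      by (intro ennreal_leI) (simp add: power_divide)
    also have "\<dots> = (\<Sum>k\<in>{n}. ennreal (b / (real k + 1) ^ 4) * indicator (?S k) x)"
      using \<open>x \<in> ?S n\<close> by simp
    also have "\<dots> \<le> (\<Sum>n. ennreal (b / (real n + 1) ^ 4) * indicator (?S n) x)"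
      by (rule sum_le_suminf) auto
    finally show ?thesis using True by simp
  qed simp
  then have "(\<integral>\<^sup>+x\<in>A. f x \<partial>M) \<le> (\<integral>\<^sup>+x. (\<Sum>n. ennreal (b / (real n + 1) ^ 4) * indicator (?S n) x) \<partial>M)"
    by (rule nn_integral_mono)
  also have "\<dots> = (\<Sum>n. \<integral>\<^sup>+x. ennreal (b / (real n + 1) ^ 4) * indicator (?S n) x \<partial>M)"
    using S by (intro nn_integral_suminf) auto
  also have "\<dots> = (\<Sum>n. ennreal (b / (real n + 1) ^ 4) * emeasure M (?S n))"
    using S by (simp add: nn_integral_cmult_indicator)
  also have "\<dots> \<le> (\<Sum>n. ennreal (4 * b * c * (1 / (real n + 1)\<^sup>2)))"
  proof (intro suminf_le)
    fix n :: nat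
    have "ennreal (b / (real n + 1) ^ 4) * emeasure M (?S n)
        \<le> ennreal (b / (real n + 1) ^ 4) * ennreal (c * (real (n + 2))\<^sup>2)"
      by (intro mult_left_mono growth) auto
    also have "\<dots> = ennreal (b / (real n + 1) ^ 4 * (c * (real (n + 2))\<^sup>2))"
      using b c by (intro ennreal_mult[symmetric]) auto
    also have "\<dots> \<le> ennreal (b / (real n + 1) ^ 4 * (c * (2 * (real n + 1))\<^sup>2))"
      using b c by (intro ennreal_leI mult_left_mono power_mono) auto
    also have "b / (real n + 1) ^ 4 * (c * (2 * (real n + 1))\<^sup>2) = 4 * b * c * (1 / (real n + 1)\<^sup>2)"
    proof -
      have "b / y ^ 4 * (c * (2 * y)\<^sup>2) = 4 * b * c * (1 / y\<^sup>2)" if "y \<noteq> 0" for y :: real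
        using that by (simp add: field_simps power2_eq_square eval_nat_numeral)
      from this[of "real n + 1"] show ?thesis by linarith
    qed
    finally show "ennreal (b / (real n + 1) ^ 4) * emeasure M (?S n) \<le> ennreal (4 * b * c * (1 / (real n + 1)\<^sup>2))" .
  qed auto
  also have "\<dots> = ennreal (4 * b * c * (pi\<^sup>2 / 6))"
    using b c sums_mult[OF inverse_squares_sums, of "4 * b * c"]
    by (intro suminf_ennreal_eq) (auto simp: add.commute)
  finally show ?thesis by (simp add: mult_ac)
qed

text \<open>The domain lies in a disc whose boundary circle passes through this point, so that there is room for
  exterior discs of every radius beyond the tangent line at the point.\<close>

lemma farthest_point:
  fixes \<Omega> :: "(real^2) set"
  assumes "open \<Omega>" "bounded \<Omega>" "\<Omega> \<noteq> {}"
  obtains x0 where "x0 \<in> frontier \<Omega>" "0 < norm x0" "\<And>x. x \<in> \<Omega> \<Longrightarrow> norm x < norm x0"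
proof -
  have "compact (closure \<Omega>)" using assms by (simp add: compact_closure)
  then obtain x0 where x0: "x0 \<in> closure \<Omega>" "\<And>x. x \<in> closure \<Omega> \<Longrightarrow> norm x \<le> norm x0"
    using continuous_attains_sup[of "closure \<Omega>" norm] assms by (auto intro: continuous_intros)
  have strict: "norm x < norm x0" if x: "x \<in> \<Omega>" for x
  proof -
    obtain d where d: "0 < d" "cball x d \<subseteq> \<Omega>"
      using \<open>open \<Omega>\<close> x by (auto simp: open_contains_cball)
    obtain v :: "real^2" where v: "norm v = 1" "x = norm x *\<^sub>R v"
    proof (cases "x = 0")
      case True
      then show ?thesis using that[of "axis 1 1"] by (simp add: norm_axis_1)
    next
      case False
      then show ?thesis using that[of "sgn x"] by (simp add: norm_sgn sgn_div_norm)
    qed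
    have "x + d *\<^sub>R v \<in> cball x d" using v d by (simp add: dist_norm)
    then have "x + d *\<^sub>R v \<in> closure \<Omega>" using d(2) closure_subset by blast
    then have "norm (x + d *\<^sub>R v) \<le> norm x0" by (rule x0(2))
    moreover have "x + d *\<^sub>R v = (norm x + d) *\<^sub>R v" by (subst v(2)) (simp add: scaleR_add_left)
    ultimately show ?thesis using d(1) v(1) by simp
  qed
  show thesis
  proof (rule that[of x0])
    show "x0 \<in> frontier \<Omega>"
      using x0(1) strict[of x0] \<open>open \<Omega>\<close> by (auto simp: frontier_def interior_open)
    obtain x where "x \<in> \<Omega>" using assms by blast
    then show "0 < norm x0" using strict[of x] norm_ge_zero[of x] by linarith
  qed (rule strict)
qed

lemma energy_density_le:
  fixes G w \<epsilon> r :: real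
  assumes \<epsilon>: "0 < \<epsilon>" and r: "\<epsilon> \<le> r" and G: "G \<le> (120 * \<epsilon>\<^sup>2 / r ^ 3)\<^sup>2" and w: "w \<le> 576 * (\<epsilon> / r) ^ 4"
  shows "1 / 2 * G + 1 / (4 * \<epsilon>\<^sup>2) * w \<le> 8000 / \<epsilon>\<^sup>2 * (\<epsilon> / r) ^ 4"
proof -
  have r0: "0 < r" using assms by simp
  have "(120 * \<epsilon>\<^sup>2 / r ^ 3)\<^sup>2 = 14400 / \<epsilon>\<^sup>2 * ((\<epsilon> / r)\<^sup>2 * (\<epsilon> / r) ^ 4)"
    using \<epsilon> r0 by (simp add: field_simps eval_nat_numeral)
  also have "(\<epsilon> / r)\<^sup>2 * (\<epsilon> / r) ^ 4 \<le> 1 * (\<epsilon> / r) ^ 4"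
    using \<epsilon> r r0 by (intro mult_right_mono power_le_one) auto
  finally have "G \<le> 14400 / \<epsilon>\<^sup>2 * (\<epsilon> / r) ^ 4" using G \<epsilon> by (simp add: mult_left_mono divide_right_mono)
  moreover have "1 / (4 * \<epsilon>\<^sup>2) * w \<le> 1 / (4 * \<epsilon>\<^sup>2) * (576 * (\<epsilon> / r) ^ 4)"
    using \<epsilon> w by (intro mult_left_mono) auto
  moreover have "1 / (4 * \<epsilon>\<^sup>2) * (576 * (\<epsilon> / r) ^ 4) = 144 * ((\<epsilon> / r) ^ 4 / \<epsilon>\<^sup>2)"
    "14400 / \<epsilon>\<^sup>2 * (\<epsilon> / r) ^ 4 = 14400 * ((\<epsilon> / r) ^ 4 / \<epsilon>\<^sup>2)"
    "8000 / \<epsilon>\<^sup>2 * (\<epsilon> / r) ^ 4 = 8000 * ((\<epsilon> / r) ^ 4 / \<epsilon>\<^sup>2)" by simp_all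
  moreover have "0 \<le> (\<epsilon> / r) ^ 4 / \<epsilon>\<^sup>2" using \<epsilon> r0 by simp
  ultimately show ?thesis by linarith
qed


theorem proposition3:
  shows "\<exists>C :: real \<Rightarrow> real \<Rightarrow> real. (\<forall>\<rho> \<theta>. 0 < C \<rho> \<theta>) \<and>
    (\<forall>\<Omega> :: (real^2) set. bounded_lipschitz_domain \<Omega> \<longrightarrow>
       (\<exists>\<rho> \<theta>. lipschitz_regularity \<Omega> \<rho> \<theta>) \<and>
       (\<exists>x0\<in>frontier \<Omega>. \<exists>\<epsilon>0>0. \<forall>\<epsilon>. 0 < \<epsilon> \<and> \<epsilon> < \<epsilon>0 \<longrightarrow>
          (\<exists>g u. abs_continuous_along (frontier \<Omega>) g \<and>
                 gl_solution \<epsilon> \<Omega> g u \<and>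
                 g x0 = 0 \<and>
                 (\<forall>\<rho> \<theta>. lipschitz_regularity \<Omega> \<rho> \<theta> \<longrightarrow>
                    interior_energy \<epsilon> \<Omega> u \<le> ennreal (C \<rho> \<theta>) \<and>
                    boundary_energy \<epsilon> \<Omega> g \<le> ennreal (C \<rho> \<theta> / \<epsilon>)))))"
proof -
  have "\<exists>K>0. \<forall>\<Omega> \<rho> a s. open \<Omega> \<longrightarrow> lipschitz_regularity \<Omega> \<rho> \<theta> \<longrightarrow> 0 \<le> s \<longrightarrow> 2 * s < \<rho> \<longrightarrow>
      hausdorff_outer (frontier \<Omega> \<inter> cball a s) \<le> ennreal (K * s)" for \<theta>
  proof (cases "0 < \<theta> \<and> \<theta> < pi")
    case True
    then have "0 < \<theta>" "\<theta> < pi" by auto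
    then show ?thesis
    proof (rule frontier_hausdorff_ball_le)
      fix K :: real
      assume "0 < K" "\<And>\<Omega> \<rho> a s. \<lbrakk>open \<Omega>; lipschitz_regularity \<Omega> \<rho> \<theta>; 0 \<le> s; 2 * s < \<rho>\<rbrakk> \<Longrightarrow>
        hausdorff_outer (frontier \<Omega> \<inter> cball a s) \<le> ennreal (K * s)"
      then show ?thesis by blast
    qed
  next
    case False
    then have "\<not> lipschitz_regularity \<Omega> \<rho> \<theta>" for \<Omega> \<rho> by (auto simp: lipschitz_regularity_def)
    then show ?thesis by (blast intro: zero_less_one)
  qed
  then have "\<exists>K. \<forall>\<theta>. 0 < K \<theta> \<and> (\<forall>\<Omega> \<rho> a s. open \<Omega> \<longrightarrow> lipschitz_regularity \<Omega> \<rho> \<theta> \<longrightarrow> 0 \<le> s \<longrightarrow> 2 * s < \<rho> \<longrightarrow>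
      hausdorff_outer (frontier \<Omega> \<inter> cball a s) \<le> ennreal (K \<theta> * s))"
    by (intro choice allI)
  then obtain K where K0: "\<And>\<theta>. 0 < K \<theta>"
    and K: "\<And>\<Omega> \<rho> \<theta> a s. open \<Omega> \<Longrightarrow> lipschitz_regularity \<Omega> \<rho> \<theta> \<Longrightarrow> 0 \<le> s \<Longrightarrow> 2 * s < \<rho> \<Longrightarrow>
      hausdorff_outer (frontier \<Omega> \<inter> cball a s) \<le> ennreal (K \<theta> * s)"
    by blast
  (* the factor pi^2/6 is the sum of the inverse squares, 8000 bounds the energy density *)
  define \<Lambda> :: real where "\<Lambda> = 4 * (pi\<^sup>2 / 6) * 8000"
  have \<Lambda>: "0 < \<Lambda>" by (simp add: \<Lambda>_def)
  define C where "C \<rho> \<theta> = \<Lambda> * (pi + (K \<theta> + 4 / \<rho>\<^sup>2))" for \<rho> \<theta>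
  have C: "0 < C \<rho> \<theta>" "\<Lambda> * pi \<le> C \<rho> \<theta>" "\<Lambda> * (K \<theta> + 4 / \<rho>\<^sup>2) \<le> C \<rho> \<theta>" for \<rho> \<theta>
  proof -
    have "0 \<le> 4 / \<rho>\<^sup>2" by simp
    then show "0 < C \<rho> \<theta>" unfolding C_def using \<Lambda> K0[of \<theta>] pi_gt_zero by (intro mult_pos_pos) linarith+
    show "\<Lambda> * pi \<le> C \<rho> \<theta>" "\<Lambda> * (K \<theta> + 4 / \<rho>\<^sup>2) \<le> C \<rho> \<theta>"
      unfolding C_def using \<Lambda> K0[of \<theta>] pi_gt_zero \<open>0 \<le> 4 / \<rho>\<^sup>2\<close> by (intro mult_left_mono; linarith)+
  qed
  show ?thesis
  proof (intro exI[of _ C] conjI allI impI)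
    show "0 < C \<rho> \<theta>" for \<rho> \<theta> by (rule C)
    fix \<Omega> :: "(real^2) set"
    assume "bounded_lipschitz_domain \<Omega>"
    then have op: "open \<Omega>" and bdd: "bounded \<Omega>" and ne: "\<Omega> \<noteq> {}" and lip: "lipschitz_boundary \<Omega>"
      by (auto simp: bounded_lipschitz_domain_def)
    show ex: "\<exists>\<rho> \<theta>. lipschitz_regularity \<Omega> \<rho> \<theta>"
      by (rule lipschitz_regularity_exists[OF op bdd lip])
    then have "hausdorff_outer (frontier \<Omega>) < \<infinity>"
      using frontier_hausdorff_finite[OF op bdd] by blast
    then obtain H where H: "0 \<le> H" "hausdorff_outer (frontier \<Omega>) = ennreal H"
      by (cases "hausdorff_outer (frontier \<Omega>)") auto
    obtain x0 where x0: "x0 \<in> frontier \<Omega>" "0 < norm x0" "\<And>x. x \<in> \<Omega> \<Longrightarrow> norm x < norm x0"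
      using farthest_point[OF op bdd ne] by blast
    show "\<exists>x0\<in>frontier \<Omega>. \<exists>\<epsilon>0>0. \<forall>\<epsilon>. 0 < \<epsilon> \<and> \<epsilon> < \<epsilon>0 \<longrightarrow>
          (\<exists>g u. abs_continuous_along (frontier \<Omega>) g \<and>
                 gl_solution \<epsilon> \<Omega> g u \<and>
                 g x0 = 0 \<and>
                 (\<forall>\<rho> \<theta>. lipschitz_regularity \<Omega> \<rho> \<theta> \<longrightarrow>
                    interior_energy \<epsilon> \<Omega> u \<le> ennreal (C \<rho> \<theta>) \<and>
                    boundary_energy \<epsilon> \<Omega> g \<le> ennreal (C \<rho> \<theta> / \<epsilon>)))"
    proof (intro bexI[OF _ x0(1)] exI[of _ "1 / (H + 1)"] conjI allI impI)
      show "0 < 1 / (H + 1)" using H by simp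
      fix \<epsilon> assume "0 < \<epsilon> \<and> \<epsilon> < 1 / (H + 1)"
      then have \<epsilon>: "0 < \<epsilon>" and "\<epsilon> * (H + 1) < 1" using H(1) by (auto simp: field_simps)
      then have H\<epsilon>: "H * \<epsilon> \<le> 1" by (simp add: algebra_simps)
      (* beyond x0 on its ray, at distance \<epsilon> *)
      define p where "p = ((norm x0 + \<epsilon>) / norm x0) *\<^sub>R x0"
      have norm_p: "norm p = norm x0 + \<epsilon>" using x0(2) \<epsilon> by (simp add: p_def)
      have "x0 - p = - ((\<epsilon> / norm x0) *\<^sub>R x0)"
        using x0(2) by (simp add: p_def add_divide_distrib scaleR_add_left)
      then have x0p: "dist x0 p = \<epsilon>" using x0(2) \<epsilon> by (simp add: dist_norm)
      have far: "\<epsilon> < dist x p" if "x \<in> \<Omega>" for x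
        using x0(3)[OF that] norm_p norm_triangle_ineq2[of p x] by (simp add: dist_norm norm_minus_commute)
      have far': "\<epsilon> \<le> dist x p" if "x \<in> closure \<Omega>" for x
        by (rule dist_ge_on_closure[OF less_imp_le[OF far] that])
      have fr: "frontier \<Omega> \<subseteq> closure \<Omega>" by (simp add: frontier_def)
      obtain u where sol: "gl_solution \<epsilon> \<Omega> u u"
        and zero: "\<And>x. dist x p = \<epsilon> \<Longrightarrow> u x = 0"
        and pot: "\<And>x. x \<in> closure \<Omega> \<Longrightarrow> (1 - (norm (u x))\<^sup>2)\<^sup>2 \<le> 576 * (\<epsilon> / dist x p) ^ 4"
        and grad: "\<And>x. x \<in> \<Omega> \<Longrightarrow> (\<Sum>i\<in>UNIV. (norm (partial i u x))\<^sup>2) \<le> (120 * \<epsilon>\<^sup>2 / dist x p ^ 3)\<^sup>2"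
        and lip: "\<And>x y m. \<lbrakk>x \<in> closure \<Omega>; y \<in> closure \<Omega>; \<epsilon> \<le> m; m \<le> dist x p; m \<le> dist y p\<rbrakk> \<Longrightarrow>
          norm (u x - u y) \<le> 120 * \<epsilon>\<^sup>2 / m ^ 3 * norm (x - y)"
        using gl_solution_outside_disc[OF op bdd \<epsilon> far] by blast
      have tang: "norm (tangential_deriv (frontier \<Omega>) u x) \<le> 120 * \<epsilon>\<^sup>2 / dist x p ^ 3"
        if x: "x \<in> frontier \<Omega>" for x
      proof (rule norm_tangential_deriv_le)
        have r: "0 < dist x p" using far'[of x] x fr \<epsilon> by force
        then show "0 \<le> 120 * \<epsilon>\<^sup>2 / dist x p ^ 3" by simp
        fix M' assume M': "120 * \<epsilon>\<^sup>2 / dist x p ^ 3 < M'"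
        have "((\<lambda>y. 120 * \<epsilon>\<^sup>2 / min (dist x p) (dist y p) ^ 3) \<longlongrightarrow> 120 * \<epsilon>\<^sup>2 / min (dist x p) (dist x p) ^ 3)
            (at x within frontier \<Omega>)"
          using r by (intro tendsto_intros) auto
        then have "\<forall>\<^sub>F y in at x within frontier \<Omega>. 120 * \<epsilon>\<^sup>2 / min (dist x p) (dist y p) ^ 3 < M'"
          using M' by (intro order_tendstoD(2)) auto
        moreover have "\<forall>\<^sub>F y in at x within frontier \<Omega>. y \<in> frontier \<Omega>"
          by (simp add: eventually_at_filter)
        ultimately show "\<forall>\<^sub>F y in at x within frontier \<Omega>. norm (u y - u x) \<le> M' * norm (y - x)"
        proof eventually_elim
          case (elim y)
          have "norm (u y - u x) \<le> 120 * \<epsilon>\<^sup>2 / min (dist x p) (dist y p) ^ 3 * norm (y - x)"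
            using x elim fr far' by (intro lip) auto
          also have "\<dots> \<le> M' * norm (y - x)"
            using elim by (intro mult_right_mono) auto
          finally show ?case .
        qed
      qed
      have "(120 * \<epsilon>\<^sup>2 / \<epsilon> ^ 3)-lipschitz_on (frontier \<Omega>) u"
      proof (rule lipschitz_onI)
        show "dist (u x) (u y) \<le> 120 * \<epsilon>\<^sup>2 / \<epsilon> ^ 3 * dist x y" if "x \<in> frontier \<Omega>" "y \<in> frontier \<Omega>" for x y
          unfolding dist_norm using that fr by (intro lip order_refl far') auto
      qed (use \<epsilon> in simp)
      then have AC: "abs_continuous_along (frontier \<Omega>) u"
        by (rule lipschitz_imp_abs_continuous_along)
      have b: "0 \<le> 8000 / \<epsilon>\<^sup>2" by simp
      have ie: "interior_energy \<epsilon> \<Omega> u \<le> ennreal (\<Lambda> * pi)"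
      proof -
        have "interior_energy \<epsilon> \<Omega> u \<le> ennreal (4 * (pi\<^sup>2 / 6) * (8000 / \<epsilon>\<^sup>2) * (pi * \<epsilon>\<^sup>2))"
          unfolding interior_energy_def
        proof (rule nn_integral_inverse_fourth_power_le[OF _ _ \<epsilon> b])
          fix n :: nat
          have "emeasure lborel (\<Omega> \<inter> cball p (n * \<epsilon>)) \<le> emeasure lborel (cball p (n * \<epsilon>))"
            by (intro emeasure_mono) auto
          also have "\<dots> = ennreal (pi * \<epsilon>\<^sup>2 * (real n)\<^sup>2)"
            using \<epsilon> by (simp add: emeasure_cball unit_ball_vol_2 power_mult_distrib mult_ac)
          finally show "emeasure lborel (\<Omega> \<inter> cball p (n * \<epsilon>)) \<le> ennreal (pi * \<epsilon>\<^sup>2 * (real n)\<^sup>2)" .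
        next
          fix x assume x: "x \<in> \<Omega>"
          show "ennreal (1 / 2 * (\<Sum>i\<in>UNIV. (norm (partial i u x))\<^sup>2) + 1 / (4 * \<epsilon>\<^sup>2) * (1 - (norm (u x))\<^sup>2)\<^sup>2)
              \<le> ennreal (8000 / \<epsilon>\<^sup>2 * (\<epsilon> / dist x p) ^ 4)"
            using x closure_subset[of \<Omega>]
            by (intro ennreal_leI energy_density_le \<epsilon> less_imp_le[OF far] grad pot) auto
        qed (use op far in \<open>auto intro: less_imp_le\<close>)
        also have "4 * (pi\<^sup>2 / 6) * (8000 / \<epsilon>\<^sup>2) * (pi * \<epsilon>\<^sup>2) = \<Lambda> * pi"
          using \<epsilon> by (simp add: \<Lambda>_def)
        finally show ?thesis .
      qed
      have be: "boundary_energy \<epsilon> \<Omega> u \<le> ennreal (\<Lambda> * (K \<theta> + 4 / \<rho>\<^sup>2) / \<epsilon>)"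
        if reg: "lipschitz_regularity \<Omega> \<rho> \<theta>" for \<rho> \<theta>
      proof -
        have "boundary_energy \<epsilon> \<Omega> u \<le> ennreal (4 * (pi\<^sup>2 / 6) * (8000 / \<epsilon>\<^sup>2) * ((K \<theta> + 4 / \<rho>\<^sup>2) * \<epsilon>))"
          unfolding boundary_energy_def
        proof (rule nn_integral_inverse_fourth_power_le[OF _ _ \<epsilon> b])
          fix n :: nat assume "1 \<le> n"
          then show "emeasure hausdorff_measure (frontier \<Omega> \<inter> cball p (n * \<epsilon>)) \<le> ennreal ((K \<theta> + 4 / \<rho>\<^sup>2) * \<epsilon> * (real n)\<^sup>2)"
            using H H\<epsilon> K0[of \<theta>] K[OF op reg] by (intro frontier_hausdorff_growth[OF op bdd reg \<epsilon>]) auto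
        next
          fix x assume x: "x \<in> frontier \<Omega>"
          have "(norm (tangential_deriv (frontier \<Omega>) u x))\<^sup>2 \<le> (120 * \<epsilon>\<^sup>2 / dist x p ^ 3)\<^sup>2"
            by (intro power_mono tang[OF x]) simp
          then show "ennreal (1 / 2 * (norm (tangential_deriv (frontier \<Omega>) u x))\<^sup>2 + 1 / (4 * \<epsilon>\<^sup>2) * (1 - (norm (u x))\<^sup>2)\<^sup>2)
              \<le> ennreal (8000 / \<epsilon>\<^sup>2 * (\<epsilon> / dist x p) ^ 4)"
            using x fr by (intro ennreal_leI energy_density_le \<epsilon> far' pot) auto
        qed (use fr far' \<epsilon> K0[of \<theta>] in \<open>auto intro: less_imp_le\<close>)
        also have "4 * (pi\<^sup>2 / 6) * (8000 / \<epsilon>\<^sup>2) * ((K \<theta> + 4 / \<rho>\<^sup>2) * \<epsilon>) = \<Lambda> * (K \<theta> + 4 / \<rho>\<^sup>2) / \<epsilon>"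
          using \<epsilon> by (simp add: \<Lambda>_def power2_eq_square)
        finally show ?thesis .
      qed
      show "\<exists>g u. abs_continuous_along (frontier \<Omega>) g \<and> gl_solution \<epsilon> \<Omega> g u \<and> g x0 = 0 \<and>
          (\<forall>\<rho> \<theta>. lipschitz_regularity \<Omega> \<rho> \<theta> \<longrightarrow>
             interior_energy \<epsilon> \<Omega> u \<le> ennreal (C \<rho> \<theta>) \<and> boundary_energy \<epsilon> \<Omega> g \<le> ennreal (C \<rho> \<theta> / \<epsilon>))"
      proof (intro exI[of _ u] conjI allI impI AC sol zero x0p)
        fix \<rho> \<theta> assume reg: "lipschitz_regularity \<Omega> \<rho> \<theta>"
        show "interior_energy \<epsilon> \<Omega> u \<le> ennreal (C \<rho> \<theta>)"
          using ie C(2) by (meson ennreal_leI order_trans)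
        have "\<Lambda> * (K \<theta> + 4 / \<rho>\<^sup>2) / \<epsilon> \<le> C \<rho> \<theta> / \<epsilon>"
          using C(3) \<epsilon> by (intro divide_right_mono) auto
        then show "boundary_energy \<epsilon> \<Omega> u \<le> ennreal (C \<rho> \<theta> / \<epsilon>)"
          using be[OF reg] by (meson ennreal_leI order_trans)
      qed
    qed
  qed
qed

end
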